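(* Let $(M,\mathcal{F},g)$ be an oriented Riemannian foliated manifold (ORFM) that is transversely formal and whose mean curvature one-form $\kappa$ is basic and basic harmonic. Suppose $\dim H^{1}(M,\mathcal{F})=q=\mathrm{codim}(\mathcal{F})$, and let $\alpha_1,\dots,\alpha_q$ be an orthonormal basis (for the pointwise inner product) of the space of basic harmonic $1$-forms. Then the vector fields $\alpha_1^{\sharp},\dots,\alpha_q^{\sharp}$ are foliated and commute modulo $\mathcal{F}$, i.e. $[\alpha_i^\sharp,\alpha_j^\sharp]\in\Gamma(T\mathcal{F})$ for all $i,j$. Therefore the foliation $\mathcal{F}$ is an $\mathbb{R}^{q}$-Lie foliation.
   Context: All manifolds are smooth and connected. An ORFM $(M,\mathcal{F},g)$ consists of a closed oriented Riemannian manifold $(M,g)$ and a transversely oriented foliation $\mathcal{F}$ (tangent bundle $T\mathcal{F}$) for which $g$ is bundle-like: with $Q=(T\mathcal{F})^{\perp}$, the induced metric $g_Q$ on $Q$ (extended by zero on $T\mathcal{F}$) satisfies $\mathcal{L}_X g_Q=0$ for all $X\in\Gamma(T\mathcal{F})$. Basic forms: $\Omega^r(M,\mathcal{F})=\{\alpha\in\Omega^r(M): X\lrcorner\alpha=X\lrcorner d\alpha=0 \text{ for all } X\in\Gamma(T\mathcal{F})\}$; $H^r(M,\mathcal{F})$ is the cohomology of $(\Omega^*(M,\mathcal{F}),d)$. Let $\delta_b$ be the formal adjoint of $d$ on $\Omega^*(M,\mathcal{F})$ for the $L^2$ inner product of $(M,g)$. A basic form $\alpha$ is basic harmonic if $d\alpha=0$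 and $\delta_b\alpha=0$. Mean curvature: $\kappa$ is dual to $\kappa^{\#}=\sum_j\pi(\nabla^M_{f_j}f_j)$, where $\pi:TM\to Q$ is the orthogonal projection, $\{f_j\}$ is a local orthonormal frame of $T\mathcal{F}$ and $\nabla^M$ is the Levi-Civita connection of $(M,g)$; $\kappa_b$ is the $L^2$-orthogonal projection of $\kappa$ to the basic forms. A basic form $\alpha$ is basic $\kappa_b$-harmonic if $d\alpha=\kappa_b\wedge\alpha$ and $\delta_b\alpha=\kappa_b\lrcorner\alpha$. $(M,\mathcal{F},g)$ is transversely formal if the wedge product of any basic harmonic form and any basic $\kappa_b$-harmonic form is basic $\kappa_b$-harmonic. (In this case pointwise inner products of basic harmonic forms of equal degree are constant functions.) A vector field $X$ on $M$ is foliated if $[X,Y]\in\Gamma(T\mathcal{F})$ for all $Y\in\Gamma(T\mathcal{F})$. A codimension $q$ foliation is a $\mathfrak{g}$-Lie foliation if there exist foliated vector fields $X_1,\dots,X_q$ whose projections to $Q$ are linearly independent and such that $[X_i,X_j]=\sum_k c_{ij}^kX_k \bmod \Gamma(T\mathcal{F})$, where $c_{ij}^k$ are the structure constants of the Lie algebra $\mathfrak{g}$; an $\mathbb{R}^q$-Lie foliation is the case of the abelian Lie algebra $\mathfrak{g}=\mathbb{R}^q$. *)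

theory Defs
  imports "HOL-Analysis.Analysis" "HOL-Combinatorics.Permutations"
begin

section \<open>Smooth maps between open subsets of Euclidean spaces\<close>

text \<open>Meant for open \<open>S\<close>.\<close>

fun Ck_on :: "nat \<Rightarrow> ('e::real_normed_vector \<Rightarrow> 'f::real_normed_vector) \<Rightarrow> 'e set \<Rightarrow> bool" where
  "Ck_on 0 f S \<longleftrightarrow> continuous_on S f"
| "Ck_on (Suc k) f S \<longleftrightarrow>
     (\<forall>x\<in>S. f differentiable (at x)) \<and> (\<forall>v. Ck_on k (\<lambda>x. frechet_derivative f (at x) v) S)"

definition smooth_on :: "'e::real_normed_vector set \<Rightarrow> ('e \<Rightarrow> 'f::real_normed_vector) \<Rightarrow> bool" where
  "smooth_on S f \<longleftrightarrow> (\<forall>k. Ck_on k f S)"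


section \<open>Foliated atlases\<close>

text \<open>
  The manifold \<open>M\<close> is the whole of a topological type \<open>'a\<close>, of dimension \<open>CARD('n)\<close>.  A chart is a pair
  of its domain and a map into \<open>real ^ 'n\<close>.  Of the coordinates, those with index in \<open>transv M\<close> are the
  transverse ones, the others are the leafwise ones; a foliation is given by an atlas whose
  coordinate changes are locally of the form \<open>(x, y) \<mapsto> (f (x, y), h y)\<close> with \<open>y\<close> transverse.
  Such an atlas determines the smooth structure as well as the foliation.

  The tangent space at \<open>p\<close> is identified with \<open>real ^ 'n\<close> by means of one chosen chart
  \<open>chart_at M p\<close> around \<open>p\<close>, so that a vector field is a map \<open>'a \<Rightarrow> real ^ 'n\<close> and a form is a map that sends
  each point to a function of lists of tangent vectors.  The chosen chart need not depend continuously
  on the point; smoothness is always tested in the coordinates of the charts (\<open>vec_rep\<close>, \<open>form_rep\<close>,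
  \<open>metric_rep\<close> below), and all derivatives at \<open>p\<close> are computed in the coordinates \<open>chart_at M p\<close>.
  By the usual transformation rules, nothing below depends on the choice made by \<open>chart_at\<close>.
\<close>

type_synonym ('a, 'n) chart = "'a set \<times> ('a \<Rightarrow> real ^ 'n)"

type_synonym ('a, 'n) vfield = "'a \<Rightarrow> real ^ 'n"

type_synonym ('a, 'n) form = "'a \<Rightarrow> (real ^ 'n) list \<Rightarrow> real"

text \<open>
  \<open>orient M p\<close> and \<open>torient M p\<close> are \<open>1\<close> or \<open>- 1\<close>: the sign, with respect to the given orientation, of the
  basis of \<open>T\<^sub>pM\<close> (respectively of the basis of \<open>T\<^sub>pM / T\<^sub>pF\<close>) formed by the coordinate vectors
  (respectively the transverse coordinate vectors) of \<open>chart_at M p\<close>.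
\<close>

record ('a, 'n::finite) foliated_manifold =
  charts :: "('a, 'n) chart set"
  transv :: "'n set"
  metric :: "'a \<Rightarrow> real ^ 'n \<Rightarrow> real ^ 'n \<Rightarrow> real"
  orient :: "'a \<Rightarrow> real"
  torient :: "'a \<Rightarrow> real"

definition chart_inv :: "('a, 'n::finite) chart \<Rightarrow> real ^ 'n \<Rightarrow> 'a" where
  "chart_inv c = inv_into (fst c) (snd c)"

definition is_chart :: "('a::topological_space, 'n::finite) chart \<Rightarrow> bool" where
  "is_chart c \<longleftrightarrow> open (fst c) \<and> open (snd c ` fst c) \<and>
     homeomorphism (fst c) (snd c ` fst c) (snd c) (chart_inv c)"

definition codim :: "('a, 'n::finite) foliated_manifold \<Rightarrow> nat" where
  "codim M = card (transv M)"

definition foliated_atlas :: "('a::topological_space, 'n::finite) foliated_manifold \<Rightarrow> bool" where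
  "foliated_atlas M \<longleftrightarrow>
     (\<forall>c\<in>charts M. is_chart c) \<and> (\<Union>c\<in>charts M. fst c) = UNIV \<and>
     (\<forall>c\<in>charts M. \<forall>d\<in>charts M.
        smooth_on (snd c ` (fst c \<inter> fst d)) (snd d \<circ> chart_inv c) \<and>
        (\<forall>p\<in>fst c \<inter> fst d. \<exists>W. open W \<and> p \<in> W \<and> W \<subseteq> fst c \<inter> fst d \<and>
           (\<forall>x\<in>W. \<forall>y\<in>W. (\<forall>i\<in>transv M. snd c x $ i = snd c y $ i) \<longrightarrow>
                         (\<forall>i\<in>transv M. snd d x $ i = snd d y $ i))))"

definition chart_at :: "('a, 'n::finite) foliated_manifold \<Rightarrow> 'a \<Rightarrow> ('a, 'n) chart" where
  "chart_at M p = (SOME c. c \<in> charts M \<and> p \<in> fst c)"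

definition coord_at :: "('a, 'n::finite) foliated_manifold \<Rightarrow> 'a \<Rightarrow> real ^ 'n" where
  "coord_at M p = snd (chart_at M p) p"

text \<open>
  \<open>to_chart M c p\<close> is the differential at \<open>p\<close> of the chart \<open>c\<close>, and \<open>from_chart M c p\<close> is its inverse:
  the tangent vector at \<open>p\<close> with given components in the chart \<open>c\<close>.
\<close>

definition to_chart :: "('a, 'n::finite) foliated_manifold \<Rightarrow> ('a, 'n) chart \<Rightarrow> 'a \<Rightarrow> real ^ 'n \<Rightarrow> real ^ 'n" where
  "to_chart M c p = frechet_derivative (snd c \<circ> chart_inv (chart_at M p)) (at (coord_at M p))"

definition from_chart :: "('a, 'n::finite) foliated_manifold \<Rightarrow> ('a, 'n) chart \<Rightarrow> 'a \<Rightarrow> real ^ 'n \<Rightarrow> real ^ 'n" where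
  "from_chart M c p = frechet_derivative (snd (chart_at M p) \<circ> chart_inv c) (at (snd c p))"

definition transv_block :: "'n set \<Rightarrow> real ^ 'n ^ 'n \<Rightarrow> real ^ 'n ^ 'n::finite" where
  "transv_block T A =
     (\<chi> i j. if i \<in> T \<and> j \<in> T then A $ i $ j else if i = j then 1 else 0)"

definition oriented :: "('a::topological_space, 'n::finite) foliated_manifold \<Rightarrow> bool" where
  "oriented M \<longleftrightarrow> (\<forall>p. orient M p \<in> {1, -1}) \<and>
     (\<forall>c\<in>charts M. \<forall>p\<in>fst c. \<exists>W. open W \<and> p \<in> W \<and> W \<subseteq> fst c \<and>
        (\<forall>x\<in>W. orient M x * sgn (det (matrix (to_chart M c x)))
              = orient M p * sgn (det (matrix (to_chart M c p)))))"

definition transversely_oriented :: "('a::topological_space, 'n::finite) foliated_manifold \<Rightarrow> bool" where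
  "transversely_oriented M \<longleftrightarrow> (\<forall>p. torient M p \<in> {1, -1}) \<and>
     (\<forall>c\<in>charts M. \<forall>p\<in>fst c. \<exists>W. open W \<and> p \<in> W \<and> W \<subseteq> fst c \<and>
        (\<forall>x\<in>W. torient M x * sgn (det (transv_block (transv M) (matrix (to_chart M c x))))
              = torient M p * sgn (det (transv_block (transv M) (matrix (to_chart M c p))))))"


section \<open>Functions, vector fields and the tangent bundle of the foliation\<close>

definition dir_deriv :: "('a, 'n::finite) foliated_manifold \<Rightarrow> ('a, 'n) vfield \<Rightarrow> ('a \<Rightarrow> real) \<Rightarrow> 'a \<Rightarrow> real" where
  "dir_deriv M X f p = frechet_derivative (f \<circ> chart_inv (chart_at M p)) (at (coord_at M p)) (X p)"

definition vec_rep :: "('a, 'n::finite) foliated_manifold \<Rightarrow> ('a, 'n) chart \<Rightarrow> ('a, 'n) vfield \<Rightarrow> real ^ 'n \<Rightarrow> real ^ 'n" where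
  "vec_rep M c X x = to_chart M c (chart_inv c x) (X (chart_inv c x))"

definition vector_field_on :: "('a, 'n::finite) foliated_manifold \<Rightarrow> 'a set \<Rightarrow> ('a, 'n) vfield \<Rightarrow> bool" where
  "vector_field_on M W X \<longleftrightarrow> (\<forall>c\<in>charts M. smooth_on (snd c ` (fst c \<inter> W)) (vec_rep M c X))"

abbreviation vector_field :: "('a, 'n::finite) foliated_manifold \<Rightarrow> ('a, 'n) vfield \<Rightarrow> bool" where
  "vector_field M \<equiv> vector_field_on M UNIV"

text \<open>The derivative \<open>DY X\<close> of the components of \<open>Y\<close> along \<open>X\<close>, in the coordinates \<open>chart_at M p\<close>.\<close>

definition comp_deriv :: "('a, 'n::finite) foliated_manifold \<Rightarrow> ('a, 'n) vfield \<Rightarrow> ('a, 'n) vfield \<Rightarrow> ('a, 'n) vfield" where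
  "comp_deriv M X Y p = frechet_derivative (vec_rep M (chart_at M p) Y) (at (coord_at M p)) (X p)"

definition bracket :: "('a, 'n::finite) foliated_manifold \<Rightarrow> ('a, 'n) vfield \<Rightarrow> ('a, 'n) vfield \<Rightarrow> ('a, 'n) vfield" where
  "bracket M X Y p = comp_deriv M X Y p - comp_deriv M Y X p"

text \<open>Since \<open>chart_at M p\<close> is a foliated chart, the fibre of \<open>TF\<close> at \<open>p\<close> is the same coordinate subspace for every \<open>p\<close>.\<close>

definition TF :: "('a, 'n::finite) foliated_manifold \<Rightarrow> (real ^ 'n) set" where
  "TF M = {v. \<forall>i\<in>transv M. v $ i = 0}"

definition sections_TF :: "('a, 'n::finite) foliated_manifold \<Rightarrow> ('a, 'n) vfield set" where
  "sections_TF M = {X. vector_field M X \<and> (\<forall>p. X p \<in> TF M)}"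

definition foliated :: "('a, 'n::finite) foliated_manifold \<Rightarrow> ('a, 'n) vfield \<Rightarrow> bool" where
  "foliated M X \<longleftrightarrow> vector_field M X \<and> (\<forall>Y\<in>sections_TF M. bracket M X Y \<in> sections_TF M)"


section \<open>The metric\<close>

definition metric_rep :: "('a, 'n::finite) foliated_manifold \<Rightarrow> ('a, 'n) chart \<Rightarrow> real ^ 'n \<Rightarrow> real ^ 'n \<Rightarrow> real ^ 'n \<Rightarrow> real" where
  "metric_rep M c x u v = metric M (chart_inv c x) (from_chart M c (chart_inv c x) u) (from_chart M c (chart_inv c x) v)"

definition riemannian_metric :: "('a, 'n::finite) foliated_manifold \<Rightarrow> bool" where
  "riemannian_metric M \<longleftrightarrow>
     (\<forall>p. bilinear (metric M p) \<and> (\<forall>u v. metric M p u v = metric M p v u) \<and>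
          (\<forall>v. v \<noteq> 0 \<longrightarrow> metric M p v v > 0)) \<and>
     (\<forall>c\<in>charts M. \<forall>u v. smooth_on (snd c ` fst c) (\<lambda>x. metric_rep M c x u v))"

definition normal_space :: "('a, 'n::finite) foliated_manifold \<Rightarrow> 'a \<Rightarrow> (real ^ 'n) set" where
  "normal_space M p = {v. \<forall>w\<in>TF M. metric M p v w = 0}"

definition proj_Q :: "('a, 'n::finite) foliated_manifold \<Rightarrow> 'a \<Rightarrow> real ^ 'n \<Rightarrow> real ^ 'n" where
  "proj_Q M p v = (THE w. w \<in> normal_space M p \<and> v - w \<in> TF M)"

definition metric_Q :: "('a, 'n::finite) foliated_manifold \<Rightarrow> 'a \<Rightarrow> real ^ 'n \<Rightarrow> real ^ 'n \<Rightarrow> real" where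
  "metric_Q M p u v = metric M p (proj_Q M p u) (proj_Q M p v)"

text \<open>\<open>(L\<^sub>X h)(Y, Z) = X (h (Y, Z)) - h ([X, Y], Z) - h (Y, [X, Z])\<close>\<close>

definition lie_derivative ::
  "('a, 'n::finite) foliated_manifold \<Rightarrow> ('a, 'n) vfield \<Rightarrow> ('a \<Rightarrow> real ^ 'n \<Rightarrow> real ^ 'n \<Rightarrow> real) \<Rightarrow>
   ('a, 'n) vfield \<Rightarrow> ('a, 'n) vfield \<Rightarrow> 'a \<Rightarrow> real" where
  "lie_derivative M X h Y Z p =
     dir_deriv M X (\<lambda>x. h x (Y x) (Z x)) p - h p (bracket M X Y p) (Z p) - h p (Y p) (bracket M X Z p)"

definition bundle_like :: "('a, 'n::finite) foliated_manifold \<Rightarrow> bool" where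
  "bundle_like M \<longleftrightarrow>
     (\<forall>X\<in>sections_TF M. \<forall>Y Z. vector_field M Y \<longrightarrow> vector_field M Z \<longrightarrow>
        (\<forall>p. lie_derivative M X (metric_Q M) Y Z p = 0))"

definition ORFM :: "('a::t2_space, 'n::finite) foliated_manifold \<Rightarrow> bool" where
  "ORFM M \<longleftrightarrow> compact (UNIV :: 'a set) \<and> connected (UNIV :: 'a set) \<and>
     foliated_atlas M \<and> oriented M \<and> transversely_oriented M \<and> riemannian_metric M \<and> bundle_like M"

text \<open>
  Levi-Civita connection, in the coordinates \<open>chart_at M p\<close>, with the Christoffel symbols of the first kind:
  \<open>g (\<nabla>\<^sub>X Y, u) = g (DY X, u) + (X\<^sup>i Y\<^sup>j u\<^sup>k) (\<partial>\<^sub>i g\<^sub>j\<^sub>k + \<partial>\<^sub>j g\<^sub>i\<^sub>k - \<partial>\<^sub>k g\<^sub>i\<^sub>j) / 2\<close>.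
\<close>

definition metric_deriv :: "('a, 'n::finite) foliated_manifold \<Rightarrow> 'a \<Rightarrow> real ^ 'n \<Rightarrow> real ^ 'n \<Rightarrow> real ^ 'n \<Rightarrow> real" where
  "metric_deriv M p w u v =
     frechet_derivative (\<lambda>x. metric_rep M (chart_at M p) x u v) (at (coord_at M p)) w"

definition levi_civita :: "('a, 'n::finite) foliated_manifold \<Rightarrow> ('a, 'n) vfield \<Rightarrow> ('a, 'n) vfield \<Rightarrow> ('a, 'n) vfield" where
  "levi_civita M X Y p = (THE w. \<forall>u. metric M p w u =
     metric M p (comp_deriv M X Y p) u +
     (metric_deriv M p (X p) (Y p) u + metric_deriv M p (Y p) (X p) u - metric_deriv M p u (X p) (Y p)) / 2)"


section \<open>Differential forms\<close>

text \<open>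
  A form of degree \<open>r\<close> vanishes by convention on lists of length other than \<open>r\<close>, so that equality of forms is equality of functions.
\<close>

definition alternating :: "nat \<Rightarrow> ((real ^ 'n::finite) list \<Rightarrow> real) \<Rightarrow> bool" where
  "alternating r \<omega> \<longleftrightarrow>
     (\<forall>vs. length vs \<noteq> r \<longrightarrow> \<omega> vs = 0) \<and>
     (\<forall>vs i. length vs = r \<longrightarrow> i < r \<longrightarrow> linear (\<lambda>v. \<omega> (vs[i := v]))) \<and>
     (\<forall>vs i j. length vs = r \<longrightarrow> i < j \<longrightarrow> j < r \<longrightarrow> vs ! i = vs ! j \<longrightarrow> \<omega> vs = 0)"

definition form_rep :: "('a, 'n::finite) foliated_manifold \<Rightarrow> ('a, 'n) chart \<Rightarrow> ('a, 'n) form \<Rightarrow> real ^ 'n \<Rightarrow> (real ^ 'n) list \<Rightarrow> real" where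
  "form_rep M c \<omega> x us = \<omega> (chart_inv c x) (map (from_chart M c (chart_inv c x)) us)"

definition differential_form :: "('a, 'n::finite) foliated_manifold \<Rightarrow> nat \<Rightarrow> ('a, 'n) form \<Rightarrow> bool" where
  "differential_form M r \<omega> \<longleftrightarrow> (\<forall>p. alternating r (\<omega> p)) \<and>
     (\<forall>c\<in>charts M. \<forall>us. smooth_on (snd c ` fst c) (\<lambda>x. form_rep M c \<omega> x us))"

abbreviation zero_form :: "('a, 'n::finite) form" where
  "zero_form \<equiv> (\<lambda>p vs. 0)"

definition ext_deriv :: "('a, 'n::finite) foliated_manifold \<Rightarrow> ('a, 'n) form \<Rightarrow> ('a, 'n) form" where
  "ext_deriv M \<omega> p vs =
     (\<Sum>i<length vs. (-1) ^ i *
        frechet_derivative (\<lambda>x. form_rep M (chart_at M p) \<omega> x (take i vs @ drop (Suc i) vs))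
          (at (coord_at M p)) (vs ! i))"

definition wedge :: "nat \<Rightarrow> nat \<Rightarrow> ('a, 'n::finite) form \<Rightarrow> ('a, 'n) form \<Rightarrow> ('a, 'n) form" where
  "wedge r s \<alpha> \<beta> p vs =
     (if length vs = r + s then
        (\<Sum>\<sigma> | \<sigma> permutes {..<r + s}. of_int (sign \<sigma>) *
           \<alpha> p (map (\<lambda>i. vs ! \<sigma> i) [0..<r]) * \<beta> p (map (\<lambda>i. vs ! \<sigma> i) [r..<r + s])) / (fact r * fact s)
      else 0)"

definition int_prod :: "('a, 'n::finite) vfield \<Rightarrow> ('a, 'n) form \<Rightarrow> ('a, 'n) form" where
  "int_prod X \<omega> p vs = \<omega> p (X p # vs)"

definition sharp :: "('a, 'n::finite) foliated_manifold \<Rightarrow> ('a, 'n) form \<Rightarrow> ('a, 'n) vfield" where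
  "sharp M \<alpha> p = (THE w. \<forall>v. metric M p w v = \<alpha> p [v])"

definition flat :: "('a, 'n::finite) foliated_manifold \<Rightarrow> ('a, 'n) vfield \<Rightarrow> ('a, 'n) form" where
  "flat M X p vs = (if length vs = 1 then metric M p (X p) (hd vs) else 0)"

definition basic_form :: "('a, 'n::finite) foliated_manifold \<Rightarrow> nat \<Rightarrow> ('a, 'n) form \<Rightarrow> bool" where
  "basic_form M r \<alpha> \<longleftrightarrow> differential_form M r \<alpha> \<and>
     (\<forall>X\<in>sections_TF M. int_prod X \<alpha> = zero_form \<and> int_prod X (ext_deriv M \<alpha>) = zero_form)"

text \<open>
  \<open>basis_mod Z B q b\<close>: the classes of \<open>b 0, \<dots>, b (q - 1)\<close> form a basis of the real vector space \<open>Z / B\<close>.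
\<close>

definition basis_mod :: "('a, 'n::finite) form set \<Rightarrow> ('a, 'n) form set \<Rightarrow> nat \<Rightarrow> (nat \<Rightarrow> ('a, 'n) form) \<Rightarrow> bool" where
  "basis_mod Z B q b \<longleftrightarrow> (\<forall>i<q. b i \<in> Z) \<and>
     (\<forall>z\<in>Z. \<exists>!a :: nat \<Rightarrow> real. (\<forall>i\<ge>q. a i = 0) \<and> (\<lambda>p vs. z p vs - (\<Sum>i<q. a i * b i p vs)) \<in> B)"

definition basic_cocycles :: "('a, 'n::finite) foliated_manifold \<Rightarrow> nat \<Rightarrow> ('a, 'n) form set" where
  "basic_cocycles M r = {\<alpha>. basic_form M r \<alpha> \<and> ext_deriv M \<alpha> = zero_form}"

fun basic_coboundaries :: "('a, 'n::finite) foliated_manifold \<Rightarrow> nat \<Rightarrow> ('a, 'n) form set" where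
  "basic_coboundaries M 0 = {zero_form}"
| "basic_coboundaries M (Suc r) = ext_deriv M ` {\<beta>. basic_form M r \<beta>}"

definition dim_basic_cohomology :: "('a, 'n::finite) foliated_manifold \<Rightarrow> nat \<Rightarrow> nat \<Rightarrow> bool" where
  "dim_basic_cohomology M r q \<longleftrightarrow> (\<exists>b. basis_mod (basic_cocycles M r) (basic_coboundaries M r) q b)"


section \<open>The \<open>L\<^sup>2\<close> inner product and the basic codifferential\<close>

definition orthonormal_basis :: "('a, 'n::finite) foliated_manifold \<Rightarrow> 'a \<Rightarrow> 'n \<Rightarrow> real ^ 'n" where
  "orthonormal_basis M p = (SOME e. \<forall>i j. metric M p (e i) (e j) = (if i = j then 1 else 0))"

text \<open>
  Pointwise inner product of \<open>r\<close>-forms, normalised so that the wedge products \<open>e\<^sup>i\<^sub>1 \<and> \<dots> \<and> e\<^sup>i\<^sub>r\<close> with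
  \<open>i\<^sub>1 < \<dots> < i\<^sub>r\<close> of the members of an orthonormal coframe are orthonormal.
\<close>

definition form_inner :: "('a, 'n::finite) foliated_manifold \<Rightarrow> nat \<Rightarrow> ('a, 'n) form \<Rightarrow> ('a, 'n) form \<Rightarrow> 'a \<Rightarrow> real" where
  "form_inner M r \<alpha> \<beta> p =
     (\<Sum>is | length is = r. \<alpha> p (map (orthonormal_basis M p) is) * \<beta> p (map (orthonormal_basis M p) is)) / fact r"

definition gram :: "('a, 'n::finite) foliated_manifold \<Rightarrow> ('a, 'n) chart \<Rightarrow> real ^ 'n \<Rightarrow> real ^ 'n ^ 'n" where
  "gram M c x = (\<chi> i j. metric_rep M c x (axis i 1) (axis j 1))"

text \<open>The Riemannian measure, which has density \<open>sqrt (det (g\<^sub>i\<^sub>j))\<close> in every chart.\<close>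

definition is_volume :: "('a::topological_space, 'n::finite) foliated_manifold \<Rightarrow> 'a measure \<Rightarrow> bool" where
  "is_volume M \<mu> \<longleftrightarrow> sets \<mu> = sets borel \<and>
     (\<forall>c\<in>charts M. \<forall>B\<in>sets borel. B \<subseteq> fst c \<longrightarrow>
        emeasure \<mu> B = (\<integral>\<^sup>+ x. ennreal (sqrt (det (gram M c x))) * indicator (snd c ` B) x \<partial>lborel))"

definition volume :: "('a::topological_space, 'n::finite) foliated_manifold \<Rightarrow> 'a measure" where
  "volume M = (THE \<mu>. is_volume M \<mu>)"

definition L2_inner :: "('a::topological_space, 'n::finite) foliated_manifold \<Rightarrow> nat \<Rightarrow> ('a, 'n) form \<Rightarrow> ('a, 'n) form \<Rightarrow> real" where
  "L2_inner M r \<alpha> \<beta> = (LINT p | volume M. form_inner M r \<alpha> \<beta> p)"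

text \<open>
  \<open>codiff_b M r \<alpha> \<gamma>\<close> says \<open>\<delta>\<^sub>b \<alpha> = \<gamma>\<close> for a basic form \<open>\<alpha>\<close> of degree \<open>r\<close>; as \<open>\<gamma>\<close> is basic, it is uniquely determined.
\<close>

fun codiff_b :: "('a::topological_space, 'n::finite) foliated_manifold \<Rightarrow> nat \<Rightarrow> ('a, 'n) form \<Rightarrow> ('a, 'n) form \<Rightarrow> bool" where
  "codiff_b M 0 \<alpha> \<gamma> \<longleftrightarrow> \<gamma> = zero_form"
| "codiff_b M (Suc r) \<alpha> \<gamma> \<longleftrightarrow> basic_form M r \<gamma> \<and>
     (\<forall>\<beta>. basic_form M r \<beta> \<longrightarrow> L2_inner M (Suc r) \<alpha> (ext_deriv M \<beta>) = L2_inner M r \<gamma> \<beta>)"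

definition basic_harmonic :: "('a::topological_space, 'n::finite) foliated_manifold \<Rightarrow> nat \<Rightarrow> ('a, 'n) form \<Rightarrow> bool" where
  "basic_harmonic M r \<alpha> \<longleftrightarrow> basic_form M r \<alpha> \<and> ext_deriv M \<alpha> = zero_form \<and> codiff_b M r \<alpha> zero_form"


section \<open>Mean curvature and transverse formality\<close>

definition orthonormal_TF_frame :: "('a::topological_space, 'n::finite) foliated_manifold \<Rightarrow> 'a set \<Rightarrow> (nat \<Rightarrow> ('a, 'n) vfield) \<Rightarrow> bool" where
  "orthonormal_TF_frame M W f \<longleftrightarrow> open W \<and>
     (\<forall>j<CARD('n) - codim M. vector_field_on M W (f j) \<and> (\<forall>x\<in>W. f j x \<in> TF M)) \<and>
     (\<forall>i<CARD('n) - codim M. \<forall>j<CARD('n) - codim M. \<forall>x\<in>W. metric M x (f i x) (f j x) = (if i = j then 1 else 0))"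

text \<open>The value at \<open>p\<close> does not depend on the local orthonormal frame of \<open>TF\<close> around \<open>p\<close>.\<close>

definition mean_curvature_vector :: "('a::topological_space, 'n::finite) foliated_manifold \<Rightarrow> ('a, 'n) vfield" where
  "mean_curvature_vector M p =
     (let f = (SOME f. \<exists>W. p \<in> W \<and> orthonormal_TF_frame M W f)
      in \<Sum>j<CARD('n) - codim M. proj_Q M p (levi_civita M (f j) (f j) p))"

definition mean_curvature :: "('a::topological_space, 'n::finite) foliated_manifold \<Rightarrow> ('a, 'n) form" where
  "mean_curvature M = flat M (mean_curvature_vector M)"

definition kappa_b :: "('a::topological_space, 'n::finite) foliated_manifold \<Rightarrow> ('a, 'n) form" where
  "kappa_b M = (THE \<beta>. basic_form M 1 \<beta> \<and>
     (\<forall>\<gamma>. basic_form M 1 \<gamma> \<longrightarrow> L2_inner M 1 (\<lambda>p vs. mean_curvature M p vs - \<beta> p vs) \<gamma> = 0))"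

definition basic_kappa_harmonic :: "('a::topological_space, 'n::finite) foliated_manifold \<Rightarrow> nat \<Rightarrow> ('a, 'n) form \<Rightarrow> bool" where
  "basic_kappa_harmonic M r \<alpha> \<longleftrightarrow> basic_form M r \<alpha> \<and>
     ext_deriv M \<alpha> = wedge 1 r (kappa_b M) \<alpha> \<and>
     codiff_b M r \<alpha> (int_prod (sharp M (kappa_b M)) \<alpha>)"

definition transversely_formal :: "('a::topological_space, 'n::finite) foliated_manifold \<Rightarrow> bool" where
  "transversely_formal M \<longleftrightarrow>
     (\<forall>r s \<alpha> \<beta>. basic_harmonic M r \<alpha> \<longrightarrow> basic_kappa_harmonic M s \<beta> \<longrightarrow>
        basic_kappa_harmonic M (r + s) (wedge r s \<alpha> \<beta>))"


section \<open>Lie foliations\<close>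

text \<open>
  A Lie algebra of dimension \<open>q\<close> is given by its structure constants in a basis,
  \<open>[e\<^sub>i, e\<^sub>j] = (\<Sum>k<q. C i j k *\<^sub>R e\<^sub>k)\<close>.  The abelian one is \<open>C = (\<lambda>i j k. 0)\<close>.
\<close>

definition lie_structure_constants :: "nat \<Rightarrow> (nat \<Rightarrow> nat \<Rightarrow> nat \<Rightarrow> real) \<Rightarrow> bool" where
  "lie_structure_constants q C \<longleftrightarrow>
     (\<forall>i<q. \<forall>j<q. \<forall>k<q. C i j k = - C j i k) \<and>
     (\<forall>i<q. \<forall>j<q. \<forall>k<q. \<forall>l<q.
        (\<Sum>m<q. C i j m * C m k l + C j k m * C m i l + C k i m * C m j l) = 0)"

definition lie_foliation :: "('a, 'n::finite) foliated_manifold \<Rightarrow> (nat \<Rightarrow> nat \<Rightarrow> nat \<Rightarrow> real) \<Rightarrow> bool" where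
  "lie_foliation M C \<longleftrightarrow> lie_structure_constants (codim M) C \<and>
     (\<exists>X. (\<forall>i<codim M. foliated M (X i)) \<and>
        (\<forall>p. \<forall>a :: nat \<Rightarrow> real. (\<Sum>i<codim M. a i *\<^sub>R proj_Q M p (X i p)) = 0 \<longrightarrow> (\<forall>i<codim M. a i = 0)) \<and>
        (\<forall>i<codim M. \<forall>j<codim M.
           (\<lambda>p. bracket M (X i) (X j) p - (\<Sum>k<codim M. C i j k *\<^sub>R X k p)) \<in> sections_TF M))"

abbreviation abelian_lie_foliation :: "('a, 'n::finite) foliated_manifold \<Rightarrow> bool" where
  "abelian_lie_foliation M \<equiv> lie_foliation M (\<lambda>i j k. 0)"

end

theory Submission
  imports Defs
begin

text \<open>
  Put \<open>X\<^sub>i = \<alpha>\<^sub>i\<^sup>\<sharp>\<close>.  Pointwise orthonormality means \<open>\<alpha>\<^sub>j(X\<^sub>i) = g(X\<^sub>j, X\<^sub>i) = \<delta>\<^sub>i\<^sub>j\<close>: all these functions are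
  constant.  Since \<open>\<alpha>\<^sub>j\<close> is closed, the formula
  \<open>d\<alpha>(X, Y) = X(\<alpha>(Y)) - Y(\<alpha>(X)) - \<alpha>([X, Y])\<close> shows \<open>\<alpha>\<^sub>j([X\<^sub>i, Y]) = 0\<close> for every vector field \<open>Y\<close> on
  which all \<open>\<alpha>\<^sub>j\<close> are constant (\<open>closed_one_form_bracket\<close>).  This applies to \<open>Y = X\<^sub>k\<close>, and also to sections \<open>Y\<close>
  of \<open>TF\<close>, on which basic forms vanish.  The common kernel of \<open>q = codim F\<close> orthonormal basic
  one-forms is exactly \<open>TF\<close>, by counting dimensions (\<open>orthogonal_complement_eq\<close>), so in both cases the
  bracket is tangent to the leaves.  That is all a Lie foliation with abelian structure algebra requires,
  the \<open>X\<^sub>i\<close> being normal to the leaves and orthonormal.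

  The rest consists of the differential geometry which this argument takes for granted.  That the bracket
  of two vector fields is again a smooth vector field (\<open>vector_field_bracket\<close>) means that its coordinate
  formula is compatible with changes of charts; the terms that obstruct this are second derivatives of a
  transition map, and they cancel because these are symmetric (\<open>second_derivative_symmetric\<close>).
  The field dual to a smooth form is smooth by Cramer's rule (\<open>vector_field_sharp\<close>).  The definition of
  basic forms tests them on global sections of \<open>TF\<close> only, so that a pointwise statement needs a global
  section through any given vector; it is made with a smooth bump function (\<open>sections_TF_through\<close>).
\<close>

section \<open>Closure properties of smooth maps\<close>

lemma Ck_on_cong:
  assumes "open S" "\<And>x. x \<in> S \<Longrightarrow> f x = g x" "Ck_on k f S"
  shows "Ck_on k g S"
  using assms
proof (induction k arbitrary: f g)
  case 0
  then show ?case by (simp cong: continuous_on_cong)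
next
  case (Suc k)
  have d: "(g has_derivative frechet_derivative f (at x)) (at x)" if "x \<in> S" for x
    using has_derivative_transform_within_open[OF _ \<open>open S\<close> that Suc.prems(2)] Suc.prems(3) that
    by (auto simp: frechet_derivative_works)
  then have "frechet_derivative f (at x) = frechet_derivative g (at x)" if "x \<in> S" for x
    using that frechet_derivative_at by blast
  then show ?case
    using Suc.IH[OF \<open>open S\<close>, of "\<lambda>x. frechet_derivative f (at x) v" "\<lambda>x. frechet_derivative g (at x) v" for v]
      Suc.prems(3) d by (auto simp: differentiable_def)
qed

text \<open>The recursion for \<open>Ck_on\<close> is phrased in terms of \<open>frechet_derivative\<close>, which is awkward to compute with; any
  explicit formula for the derivative serves as well.\<close>

lemma Ck_on_SucI:
  assumes "open S" "\<And>x. x \<in> S \<Longrightarrow> (f has_derivative f' x) (at x)" "\<And>v. Ck_on k (\<lambda>x. f' x v) S"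
  shows "Ck_on (Suc k) f S"
proof -
  have "f' x = frechet_derivative f (at x)" if "x \<in> S" for x
    using frechet_derivative_at assms(2) that by blast
  then have "Ck_on k (\<lambda>x. frechet_derivative f (at x) v) S" for v
    using Ck_on_cong[OF assms(1) _ assms(3)[of v], of "\<lambda>x. frechet_derivative f (at x) v"] by simp
  with assms(2) show ?thesis by (auto simp: differentiable_def)
qed

lemma Ck_on_has_derivative:
  "Ck_on (Suc k) f S \<Longrightarrow> x \<in> S \<Longrightarrow> (f has_derivative frechet_derivative f (at x)) (at x)"
  by (simp add: frechet_derivative_works)

lemma Ck_on_Suc_imp: "Ck_on (Suc k) f S \<Longrightarrow> Ck_on k f S"
proof (induction k arbitrary: f)
  case 0
  then show ?case
    by (auto intro!: continuous_at_imp_continuous_on differentiable_imp_continuous_within)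
next
  case (Suc k)
  then show ?case by (metis Ck_on.simps(2))
qed

lemma Ck_on_subset: "Ck_on k f S \<Longrightarrow> T \<subseteq> S \<Longrightarrow> Ck_on k f T"
proof (induction k arbitrary: f)
  case 0
  then show ?case using continuous_on_subset by auto
next
  case (Suc k)
  then show ?case by auto
qed

text \<open>Smoothness of a map on a chart domain is usually known only near each point, by a different formula for
  different points.\<close>

lemma Ck_on_local:
  assumes "\<And>x. x \<in> S \<Longrightarrow> \<exists>U. open U \<and> x \<in> U \<and> Ck_on k f U"
  shows "Ck_on k f S"
  using assms
proof (induction k arbitrary: f)
  case 0
  then show ?case
    by (metis Ck_on.simps(1) continuous_at_imp_continuous_on continuous_on_eq_continuous_at)
next
  case (Suc k)
  have "f differentiable (at x)" if "x \<in> S" for x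
    using Suc.prems[OF that] by auto
  moreover have "Ck_on k (\<lambda>x. frechet_derivative f (at x) v) S" for v
    by (rule Suc.IH) (metis Ck_on.simps(2) Suc.prems)
  ultimately show ?case by simp
qed

lemma Ck_on_const: "Ck_on k (\<lambda>x. c) S"
  by (induction k arbitrary: c) simp_all

lemma Ck_on_add:
  assumes "open S"
  shows "Ck_on k f S \<Longrightarrow> Ck_on k g S \<Longrightarrow> Ck_on k (\<lambda>x. f x + g x) S"
proof (induction k arbitrary: f g)
  case 0
  then show ?case by (auto intro: continuous_intros)
next
  case (Suc k)
  show ?case
    by (rule Ck_on_SucI[OF assms has_derivative_add[OF Ck_on_has_derivative Ck_on_has_derivative],
          OF Suc.prems(1) _ Suc.prems(2)])
       (use Suc in auto)
qed

lemma Ck_on_bounded_linear: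
  assumes "open S" "bounded_linear h"
  shows "Ck_on k f S \<Longrightarrow> Ck_on k (\<lambda>x. h (f x)) S"
proof (induction k arbitrary: f)
  case 0
  then show ?case using assms(2)
    by (auto intro: bounded_linear.continuous_on)
next
  case (Suc k)
  show ?case
    by (rule Ck_on_SucI[OF assms(1) bounded_linear.has_derivative[OF assms(2) Ck_on_has_derivative[OF Suc.prems]]])
       (use Suc in auto)
qed

lemma Ck_on_bounded_bilinear:
  assumes "open S" "bounded_bilinear h"
  shows "Ck_on k f S \<Longrightarrow> Ck_on k g S \<Longrightarrow> Ck_on k (\<lambda>x. h (f x) (g x)) S"
proof (induction k arbitrary: f g)
  case 0
  then show ?case using assms(2)
    by (auto intro: bounded_bilinear.continuous_on)
next
  case (Suc k)
  have f: "Ck_on k f S" and g: "Ck_on k g S"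
    using Suc.prems Ck_on_Suc_imp by blast+
  show ?case
  proof (rule Ck_on_SucI[OF assms(1)])
    fix x assume "x \<in> S"
    then show "((\<lambda>x. h (f x) (g x)) has_derivative
      (\<lambda>v. h (f x) (frechet_derivative g (at x) v) + h (frechet_derivative f (at x) v) (g x))) (at x)"
      using Suc.prems by (intro bounded_bilinear.FDERIV[OF assms(2)] Ck_on_has_derivative)
  next
    fix v
    show "Ck_on k (\<lambda>x. h (f x) (frechet_derivative g (at x) v) + h (frechet_derivative f (at x) v) (g x)) S"
      using Suc.prems f g by (intro Ck_on_add assms Suc.IH) auto
  qed
qed

lemma Ck_on_sum:
  assumes "open S" "\<And>i. i \<in> I \<Longrightarrow> Ck_on k (f i) S"
  shows "Ck_on k (\<lambda>x. \<Sum>i\<in>I. f i x) S"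
  using assms(2)
  by (induction I rule: infinite_finite_induct) (simp_all add: Ck_on_const Ck_on_add[OF assms(1)])

lemma linear_basis_expand:
  fixes L :: "'a::euclidean_space \<Rightarrow> 'b::real_vector"
  assumes "linear L"
  shows "L v = (\<Sum>b\<in>Basis. (v \<bullet> b) *\<^sub>R L b)"
proof -
  have "L v = L (\<Sum>b\<in>Basis. (v \<bullet> b) *\<^sub>R b)" by (simp add: euclidean_representation)
  also have "\<dots> = (\<Sum>b\<in>Basis. (v \<bullet> b) *\<^sub>R L b)"
    using assms by (simp add: linear_sum linear_scale)
  finally show ?thesis .
qed

text \<open>By the chain rule the derivative of \<open>g \<circ> f\<close> is \<open>Dg (f x) (Df x v)\<close>.  Expanding the inner vector in the standard
  basis turns this into a sum of products of maps of the form \<open>Dg \<circ> f\<close> and \<open>Df\<close>, to which the induction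
  hypothesis and the product rule apply.\<close>

lemma Ck_on_compose:
  fixes f :: "'a::real_normed_vector \<Rightarrow> 'b::euclidean_space" and g :: "'b \<Rightarrow> 'c::real_normed_vector"
  assumes "open S" "open T" "\<And>x. x \<in> S \<Longrightarrow> f x \<in> T"
  shows "Ck_on k f S \<Longrightarrow> Ck_on k g T \<Longrightarrow> Ck_on k (\<lambda>x. g (f x)) S"
proof (induction k arbitrary: g)
  case 0
  then show ?case using assms(3)
    by (auto intro: continuous_on_compose2)
next
  case (Suc k)
  let ?Df = "\<lambda>x. frechet_derivative f (at x)" and ?Dg = "\<lambda>x. frechet_derivative g (at x)"
  show ?case
  proof (rule Ck_on_SucI[OF assms(1)])
    fix x assume x: "x \<in> S"
    have lin: "linear (?Dg (f x))"
      using Suc.prems(2) assms(3)[OF x] linear_frechet_derivative by auto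
    have "((\<lambda>x. g (f x)) has_derivative (\<lambda>v. ?Dg (f x) (?Df x v))) (at x)"
      by (rule has_derivative_compose[OF Ck_on_has_derivative[OF Suc.prems(1) x]
            Ck_on_has_derivative[OF Suc.prems(2) assms(3)[OF x]]])
    then show "((\<lambda>x. g (f x)) has_derivative
        (\<lambda>v. \<Sum>b\<in>Basis. (?Df x v \<bullet> b) *\<^sub>R ?Dg (f x) b)) (at x)"
      by (subst (asm) linear_basis_expand[OF lin])
  next
    fix v
    have f: "Ck_on k f S" using Suc.prems Ck_on_Suc_imp by blast
    have "Ck_on k (\<lambda>x. ?Dg (f x) b) S" for b
      using Suc.IH[OF f, of "\<lambda>y. ?Dg y b"] Suc.prems(2) by simp
    moreover have "Ck_on k (\<lambda>x. ?Df x v \<bullet> b) S" for b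
      using Suc.prems(1) by (intro Ck_on_bounded_linear[OF assms(1) bounded_linear_inner_left]) simp
    ultimately show "Ck_on k (\<lambda>x. \<Sum>b\<in>Basis. (?Df x v \<bullet> b) *\<^sub>R ?Dg (f x) b) S"
      by (intro Ck_on_sum Ck_on_bounded_bilinear[OF assms(1) bounded_bilinear_scaleR] assms)
  qed
qed

lemma Ck_on_inverse:
  fixes f :: "'a::real_normed_vector \<Rightarrow> real"
  assumes "open S" "\<And>x. x \<in> S \<Longrightarrow> f x \<noteq> 0"
  shows "Ck_on k f S \<Longrightarrow> Ck_on k (\<lambda>x. inverse (f x)) S"
proof (induction k)
  case 0
  then show ?case using assms(2) by (auto intro: continuous_intros)
next
  case (Suc k)
  let ?Df = "\<lambda>x. frechet_derivative f (at x)"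
  show ?case
  proof (rule Ck_on_SucI[OF assms(1)])
    fix x assume x: "x \<in> S"
    show "((\<lambda>x. inverse (f x)) has_derivative (\<lambda>v. (- 1) *\<^sub>R (inverse (f x) * (?Df x v * inverse (f x))))) (at x)"
      using Deriv.has_derivative_inverse[OF assms(2)[OF x] Ck_on_has_derivative[OF Suc.prems x]]
      by (simp add: mult.assoc)
  next
    fix v
    have i: "Ck_on k (\<lambda>x. inverse (f x)) S" using Suc Ck_on_Suc_imp by blast
    have "Ck_on k (\<lambda>x. ?Df x v) S" using Suc.prems by simp
    then show "Ck_on k (\<lambda>x. (- 1) *\<^sub>R (inverse (f x) * (?Df x v * inverse (f x)))) S"
      by (intro Ck_on_bounded_linear[OF assms(1) bounded_linear_scaleR_right]
            Ck_on_bounded_bilinear[OF assms(1) bounded_bilinear_mult] i)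
  qed
qed

lemma smooth_on_cong: "open S \<Longrightarrow> (\<And>x. x \<in> S \<Longrightarrow> f x = g x) \<Longrightarrow> smooth_on S f \<Longrightarrow> smooth_on S g"
  unfolding smooth_on_def using Ck_on_cong[of S f g] by simp

lemma smooth_on_subset: "smooth_on S f \<Longrightarrow> T \<subseteq> S \<Longrightarrow> smooth_on T f"
  unfolding smooth_on_def using Ck_on_subset by blast

lemma smooth_on_local:
  "(\<And>x. x \<in> S \<Longrightarrow> \<exists>U. open U \<and> x \<in> U \<and> smooth_on U f) \<Longrightarrow> smooth_on S f"
  unfolding smooth_on_def using Ck_on_local[of S _ f] by metis

lemma smooth_on_const: "smooth_on S (\<lambda>x. c)"
  unfolding smooth_on_def by (simp add: Ck_on_const)

lemma smooth_on_add:
  "open S \<Longrightarrow> smooth_on S f \<Longrightarrow> smooth_on S g \<Longrightarrow> smooth_on S (\<lambda>x. f x + g x)"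
  unfolding smooth_on_def using Ck_on_add[of S _ f g] by simp

lemma smooth_on_bounded_linear:
  "open S \<Longrightarrow> bounded_linear h \<Longrightarrow> smooth_on S f \<Longrightarrow> smooth_on S (\<lambda>x. h (f x))"
  unfolding smooth_on_def using Ck_on_bounded_linear[of S h _ f] by simp

lemma smooth_on_bounded_bilinear:
  "open S \<Longrightarrow> bounded_bilinear h \<Longrightarrow> smooth_on S f \<Longrightarrow> smooth_on S g \<Longrightarrow> smooth_on S (\<lambda>x. h (f x) (g x))"
  unfolding smooth_on_def using Ck_on_bounded_bilinear[of S h _ f g] by simp

lemma smooth_on_scaleR:
  "open S \<Longrightarrow> smooth_on S f \<Longrightarrow> smooth_on S g \<Longrightarrow> smooth_on S (\<lambda>x. f x *\<^sub>R g x)"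
  by (rule smooth_on_bounded_bilinear[OF _ bounded_bilinear_scaleR])

lemma smooth_on_mult:
  fixes f g :: "'a::real_normed_vector \<Rightarrow> real"
  shows "open S \<Longrightarrow> smooth_on S f \<Longrightarrow> smooth_on S g \<Longrightarrow> smooth_on S (\<lambda>x. f x * g x)"
  by (rule smooth_on_bounded_bilinear[OF _ bounded_bilinear_mult])

lemma smooth_on_diff:
  assumes "open S" "smooth_on S f" "smooth_on S g" shows "smooth_on S (\<lambda>x. f x - g x)"
  using smooth_on_add[OF assms(1,2) smooth_on_bounded_linear[OF assms(1) bounded_linear_minus[OF bounded_linear_ident] assms(3)]]
  by simp

lemma smooth_on_sum:
  "open S \<Longrightarrow> (\<And>i. i \<in> I \<Longrightarrow> smooth_on S (f i)) \<Longrightarrow> smooth_on S (\<lambda>x. \<Sum>i\<in>I. f i x)"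
  unfolding smooth_on_def using Ck_on_sum[of S I _ f] by simp

lemma smooth_on_prod:
  fixes f :: "'i \<Rightarrow> 'a::real_normed_vector \<Rightarrow> real"
  assumes "open S" "\<And>i. i \<in> I \<Longrightarrow> smooth_on S (f i)"
  shows "smooth_on S (\<lambda>x. \<Prod>i\<in>I. f i x)"
  using assms(2)
  by (induction I rule: infinite_finite_induct) (simp_all add: smooth_on_const smooth_on_mult[OF assms(1)])

lemma smooth_on_compose:
  fixes f :: "'a::real_normed_vector \<Rightarrow> 'b::euclidean_space" and g :: "'b \<Rightarrow> 'c::real_normed_vector"
  shows "open S \<Longrightarrow> open T \<Longrightarrow> (\<And>x. x \<in> S \<Longrightarrow> f x \<in> T) \<Longrightarrow> smooth_on S f \<Longrightarrow> smooth_on T g \<Longrightarrow>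
    smooth_on S (\<lambda>x. g (f x))"
  unfolding smooth_on_def using Ck_on_compose[of S T f _ g] by simp

lemma smooth_on_inverse:
  fixes f :: "'a::real_normed_vector \<Rightarrow> real"
  shows "open S \<Longrightarrow> (\<And>x. x \<in> S \<Longrightarrow> f x \<noteq> 0) \<Longrightarrow> smooth_on S f \<Longrightarrow> smooth_on S (\<lambda>x. inverse (f x))"
  unfolding smooth_on_def using Ck_on_inverse[of S f] by simp

lemma smooth_on_ident: "open S \<Longrightarrow> smooth_on S (\<lambda>x. x)"
  unfolding smooth_on_def
proof
  fix k assume "open S"
  show "Ck_on k (\<lambda>x. x) S"
  proof (cases k)
    case (Suc l)
    then show ?thesis by (simp add: Ck_on_const)
  qed simp
qed

lemma smooth_on_has_derivative:
  "smooth_on S f \<Longrightarrow> x \<in> S \<Longrightarrow> (f has_derivative frechet_derivative f (at x)) (at x)"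
  unfolding smooth_on_def using Ck_on_has_derivative by blast

lemma smooth_on_differentiable: "smooth_on S f \<Longrightarrow> x \<in> S \<Longrightarrow> f differentiable (at x)"
  using smooth_on_has_derivative differentiable_def by blast

lemma smooth_on_derivative: "smooth_on S f \<Longrightarrow> smooth_on S (\<lambda>x. frechet_derivative f (at x) v)"
  unfolding smooth_on_def using Ck_on.simps(2) by blast

lemma smooth_on_imp_continuous_on: "smooth_on S f \<Longrightarrow> continuous_on S f"
  unfolding smooth_on_def using Ck_on.simps(1) by blast

text \<open>Two instances occur below: the Jacobian of a transition map applied to a vector field, and a one-form evaluated
  on a vector field.  Expanding \<open>u\<close> in the standard basis reduces them to finite sums of products.\<close>

lemma smooth_on_family_apply:
  fixes F :: "'a::real_normed_vector \<Rightarrow> 'b::euclidean_space \<Rightarrow> 'c::real_normed_vector"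
  assumes "open S" "\<And>b. smooth_on S (\<lambda>x. F x b)" "\<And>x. x \<in> S \<Longrightarrow> linear (F x)" "smooth_on S u"
  shows "smooth_on S (\<lambda>x. F x (u x))"
proof (rule smooth_on_cong[OF assms(1)])
  show "smooth_on S (\<lambda>x. \<Sum>b\<in>Basis. (u x \<bullet> b) *\<^sub>R F x b)"
    by (intro smooth_on_sum[OF assms(1)] smooth_on_scaleR[OF assms(1)] assms(2)
        smooth_on_bounded_linear[OF assms(1) bounded_linear_inner_left assms(4)])
  fix x assume "x \<in> S"
  then show "(\<Sum>b\<in>Basis. (u x \<bullet> b) *\<^sub>R F x b) = F x (u x)"
    using linear_basis_expand[OF assms(3)] by metis
qed

lemma frechet_derivative_family_apply:
  fixes F :: "'a::real_normed_vector \<Rightarrow> 'b::euclidean_space \<Rightarrow> 'c::real_normed_vector"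
  assumes "open S" "\<And>b. smooth_on S (\<lambda>x. F x b)" "\<And>x. x \<in> S \<Longrightarrow> linear (F x)" "smooth_on S u" "x \<in> S"
  shows "frechet_derivative (\<lambda>y. F y (u y)) (at x) h =
    F x (frechet_derivative u (at x) h) + frechet_derivative (\<lambda>y. F y (u x)) (at x) h"
proof -
  have 1: "((\<lambda>y. \<Sum>b\<in>Basis. (u y \<bullet> b) *\<^sub>R F y b) has_derivative
     (\<lambda>h. \<Sum>b\<in>Basis. (u x \<bullet> b) *\<^sub>R frechet_derivative (\<lambda>y. F y b) (at x) h +
         (frechet_derivative u (at x) h \<bullet> b) *\<^sub>R F x b)) (at x)"
    by (intro has_derivative_sum has_derivative_scaleR has_derivative_inner_left
        smooth_on_has_derivative[OF assms(4,5)] smooth_on_has_derivative[OF assms(2,5)])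
  have 2: "((\<lambda>y. \<Sum>b\<in>Basis. (u x \<bullet> b) *\<^sub>R F y b) has_derivative
     (\<lambda>h. \<Sum>b\<in>Basis. (u x \<bullet> b) *\<^sub>R frechet_derivative (\<lambda>y. F y b) (at x) h)) (at x)"
    by (intro has_derivative_sum has_derivative_scaleR_right smooth_on_has_derivative[OF assms(2,5)])
  have "((\<lambda>y. F y (u y)) has_derivative
     (\<lambda>h. \<Sum>b\<in>Basis. (u x \<bullet> b) *\<^sub>R frechet_derivative (\<lambda>y. F y b) (at x) h +
         (frechet_derivative u (at x) h \<bullet> b) *\<^sub>R F x b)) (at x)"
    by (rule has_derivative_transform_within_open[OF 1 assms(1,5)])
      (use linear_basis_expand[OF assms(3)] in metis)
  moreover have "((\<lambda>y. F y (u x)) has_derivative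
     (\<lambda>h. \<Sum>b\<in>Basis. (u x \<bullet> b) *\<^sub>R frechet_derivative (\<lambda>y. F y b) (at x) h)) (at x)"
    by (rule has_derivative_transform_within_open[OF 2 assms(1,5)])
      (use linear_basis_expand[OF assms(3)] in metis)
  ultimately have e: "frechet_derivative (\<lambda>y. F y (u y)) (at x) =
      (\<lambda>h. \<Sum>b\<in>Basis. (u x \<bullet> b) *\<^sub>R frechet_derivative (\<lambda>y. F y b) (at x) h +
         (frechet_derivative u (at x) h \<bullet> b) *\<^sub>R F x b)"
    "frechet_derivative (\<lambda>y. F y (u x)) (at x) =
      (\<lambda>h. \<Sum>b\<in>Basis. (u x \<bullet> b) *\<^sub>R frechet_derivative (\<lambda>y. F y b) (at x) h)"
    by (auto dest!: frechet_derivative_at)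
  show ?thesis
    unfolding e sum.distrib linear_basis_expand[OF assms(3)[OF assms(5)], of "frechet_derivative u (at x) h"]
    by simp
qed

lemma linear_smooth_derivative: "smooth_on S f \<Longrightarrow> x \<in> S \<Longrightarrow> linear (frechet_derivative f (at x))"
  by (rule linear_frechet_derivative[OF smooth_on_differentiable])

lemma smooth_on_derivative_apply:
  fixes f :: "'a::euclidean_space \<Rightarrow> 'b::real_normed_vector"
  assumes "open S" "smooth_on S f" "smooth_on S u"
  shows "smooth_on S (\<lambda>x. frechet_derivative f (at x) (u x))"
  by (rule smooth_on_family_apply[OF assms(1) smooth_on_derivative[OF assms(2)]
        linear_smooth_derivative[OF assms(2)] assms(3)])

lemma smooth_on_det:
  fixes A :: "'a::real_normed_vector \<Rightarrow> real ^ 'n ^ 'n::finite"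
  assumes "open S" "\<And>i j. smooth_on S (\<lambda>x. A x $ i $ j)"
  shows "smooth_on S (\<lambda>x. det (A x))"
  unfolding det_def
  by (intro smooth_on_sum[OF assms(1)] smooth_on_mult[OF assms(1)] smooth_on_prod[OF assms(1)] assms(2) smooth_on_const)

lemma smooth_on_vec:
  fixes f :: "'a::real_normed_vector \<Rightarrow> real ^ 'n::finite"
  assumes "open S" "\<And>i. smooth_on S (\<lambda>x. f x $ i)"
  shows "smooth_on S f"
proof (rule smooth_on_cong[OF assms(1)])
  show "smooth_on S (\<lambda>x. \<Sum>i\<in>UNIV. (f x $ i) *\<^sub>R axis i (1::real))"
    by (intro smooth_on_sum[OF assms(1)] smooth_on_scaleR[OF assms(1)] assms(2) smooth_on_const)
  show "(\<Sum>i\<in>UNIV. (f x $ i) *\<^sub>R axis i (1::real)) = f x" for x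
    by (simp add: basis_expansion flip: scalar_mult_eq_scaleR)
qed

section \<open>Symmetry of second derivatives\<close>

text \<open>Two applications of the mean value theorem: along \<open>u\<close> to the increment of \<open>f\<close> in the direction \<open>v\<close>, and
  then along \<open>v\<close> to the derivative of \<open>f\<close> in the direction \<open>u\<close>.\<close>

lemma second_difference:
  fixes f :: "'a::real_normed_vector \<Rightarrow> real"
  assumes S: "open S" "smooth_on S f" and t: "0 < t"
    and box: "\<And>a b. 0 \<le> a \<Longrightarrow> a \<le> t \<Longrightarrow> 0 \<le> b \<Longrightarrow> b \<le> t \<Longrightarrow> x + a *\<^sub>R u + b *\<^sub>R v \<in> S"
  obtains a b where "0 < a" "a < t" "0 < b" "b < t"
    "f (x + t *\<^sub>R u + t *\<^sub>R v) - f (x + t *\<^sub>R u) - f (x + t *\<^sub>R v) + f x =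
     t * t * frechet_derivative (\<lambda>y. frechet_derivative f (at y) u) (at (x + a *\<^sub>R u + b *\<^sub>R v)) v"
proof -
  let ?D = "\<lambda>y. frechet_derivative f (at y) u"
  let ?E = "\<lambda>y. frechet_derivative ?D (at y) v"
  have dS: "((\<lambda>s. g (y + s *\<^sub>R w)) has_real_derivative frechet_derivative g (at (y + s *\<^sub>R w)) w) (at s)"
    if "smooth_on S g" "y + s *\<^sub>R w \<in> S" for g :: "'a \<Rightarrow> real" and s y w
  proof -
    have "((\<lambda>s. y + s *\<^sub>R w) has_derivative (\<lambda>h. h *\<^sub>R w)) (at s)"
      by (auto intro!: derivative_eq_intros)
    from has_derivative_compose[OF this smooth_on_has_derivative[OF that]]
    have "((\<lambda>s. g (y + s *\<^sub>R w)) has_derivative (\<lambda>h. frechet_derivative g (at (y + s *\<^sub>R w)) (h *\<^sub>R w))) (at s)" .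
    moreover have "linear (frechet_derivative g (at (y + s *\<^sub>R w)))"
      using linear_frechet_derivative[OF smooth_on_differentiable[OF that]] .
    ultimately show ?thesis
      unfolding has_field_derivative_def by (simp add: linear_scale mult.commute[of _ "frechet_derivative g (at (y + s *\<^sub>R w)) w"])
  qed
  let ?\<phi> = "\<lambda>s. f (x + s *\<^sub>R u + t *\<^sub>R v) - f (x + s *\<^sub>R u)"
  have "(?\<phi> has_real_derivative ?D (x + s *\<^sub>R u + t *\<^sub>R v) - ?D (x + s *\<^sub>R u)) (at s)"
    if "0 \<le> s" "s \<le> t" for s
  proof (rule DERIV_diff)
    have "x + t *\<^sub>R v + s *\<^sub>R u \<in> S" using box[of s t] that t by (simp add: algebra_simps)
    from dS[OF S(2) this] show "((\<lambda>s. f (x + s *\<^sub>R u + t *\<^sub>R v)) has_real_derivative ?D (x + s *\<^sub>R u + t *\<^sub>R v)) (at s)"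
      by (simp add: algebra_simps)
    have "x + s *\<^sub>R u \<in> S" using box[of s 0] that t by simp
    from dS[OF S(2) this] show "((\<lambda>s. f (x + s *\<^sub>R u)) has_real_derivative ?D (x + s *\<^sub>R u)) (at s)" .
  qed
  from MVT2[OF t this] obtain a where a: "0 < a" "a < t"
    "?\<phi> t - ?\<phi> 0 = (t - 0) * (?D (x + a *\<^sub>R u + t *\<^sub>R v) - ?D (x + a *\<^sub>R u))" by metis
  have "((\<lambda>s. ?D (x + a *\<^sub>R u + s *\<^sub>R v)) has_real_derivative ?E (x + a *\<^sub>R u + s *\<^sub>R v)) (at s)"
    if "0 \<le> s" "s \<le> t" for s
    using dS[OF smooth_on_derivative[OF S(2)] box[of a s]] a that by simp
  from MVT2[OF t this] obtain b where b: "0 < b" "b < t"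
    "?D (x + a *\<^sub>R u + t *\<^sub>R v) - ?D (x + a *\<^sub>R u + 0 *\<^sub>R v) = (t - 0) * ?E (x + a *\<^sub>R u + b *\<^sub>R v)" by metis
  have "?\<phi> t - ?\<phi> 0 = t * t * ?E (x + a *\<^sub>R u + b *\<^sub>R v)"
    using a(3) b(3) by simp
  then have "f (x + t *\<^sub>R u + t *\<^sub>R v) - f (x + t *\<^sub>R u) - f (x + t *\<^sub>R v) + f x
     = t * t * ?E (x + a *\<^sub>R u + b *\<^sub>R v)" by simp
  with a b that show ?thesis by blast
qed

text \<open>The second difference is symmetric in \<open>u\<close> and \<open>v\<close>, so the two mixed derivatives agree at two points
  of an arbitrarily small parallelogram; then they agree at the corner, by continuity.\<close>

lemma second_derivative_symmetric_real:
  fixes f :: "'a::real_normed_vector \<Rightarrow> real"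
  assumes "open S" "smooth_on S f" "x \<in> S"
  shows "frechet_derivative (\<lambda>y. frechet_derivative f (at y) u) (at x) v =
         frechet_derivative (\<lambda>y. frechet_derivative f (at y) v) (at x) u"
proof -
  let ?E = "\<lambda>u v y. frechet_derivative (\<lambda>y. frechet_derivative f (at y) u) (at y) v"
  obtain r where r: "0 < r" "ball x r \<subseteq> S" using assms openE by blast
  \<comment> \<open>The side lengths \<open>t n\<close> tend to zero and are small enough for the parallelograms to stay in the ball.\<close>
  define c where "c = norm u + norm v + 1"
  have c: "c > 0" unfolding c_def by (smt (verit) norm_ge_zero)
  define t where "t n = r / (2 * c) / real (Suc n)" for n
  have t: "t n > 0" for n using r c by (simp add: t_def)
  have t0: "t \<longlonglongrightarrow> 0" unfolding t_def by (rule lim_const_over_n[THEN LIMSEQ_Suc])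
  have small: "norm (a *\<^sub>R u + b *\<^sub>R v) \<le> t n * c" if "0 \<le> a" "a \<le> t n" "0 \<le> b" "b \<le> t n" for a b n
  proof -
    have "norm (a *\<^sub>R u + b *\<^sub>R v) \<le> a * norm u + b * norm v"
      using norm_triangle_ineq[of "a *\<^sub>R u" "b *\<^sub>R v"] that by simp
    also have "\<dots> \<le> t n * norm u + t n * norm v"
      using that by (intro add_mono mult_right_mono) auto
    also have "\<dots> \<le> t n * c" using t[of n] by (simp add: c_def algebra_simps)
    finally show ?thesis .
  qed
  have tc: "t n * c < r" for n
  proof -
    have "t n * c = r / 2 / real (Suc n)" unfolding t_def using c by simp
    also have "\<dots> \<le> r / 2 / 1" using r by (intro divide_left_mono) auto
    finally show ?thesis using r by linarith
  qed
  have box: "x + a *\<^sub>R u + b *\<^sub>R v \<in> S" if "0 \<le> a" "a \<le> t n" "0 \<le> b" "b \<le> t n" for a b n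
  proof -
    have "x - (x + a *\<^sub>R u + b *\<^sub>R v) = - (a *\<^sub>R u + b *\<^sub>R v)" by simp
    then have "dist x (x + a *\<^sub>R u + b *\<^sub>R v) = norm (a *\<^sub>R u + b *\<^sub>R v)"
      by (simp only: dist_norm norm_minus_cancel)
    then have "dist x (x + a *\<^sub>R u + b *\<^sub>R v) < r" using small[OF that] tc[of n] by linarith
    then show ?thesis using r(2) by auto
  qed
  have ex: "\<exists>y. (\<forall>n. norm (y n - x) \<le> t n * c) \<and> (\<forall>n.
      f (x + t n *\<^sub>R u + t n *\<^sub>R v) - f (x + t n *\<^sub>R u) - f (x + t n *\<^sub>R v) + f x = t n * t n * ?E u v (y n))"
  proof -
    have "\<exists>y. norm (y - x) \<le> t n * c \<and>
      f (x + t n *\<^sub>R u + t n *\<^sub>R v) - f (x + t n *\<^sub>R u) - f (x + t n *\<^sub>R v) + f x = t n * t n * ?E u v y" for n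
    proof -
      obtain a b where ab: "0 < a" "a < t n" "0 < b" "b < t n"
        "f (x + t n *\<^sub>R u + t n *\<^sub>R v) - f (x + t n *\<^sub>R u) - f (x + t n *\<^sub>R v) + f x
           = t n * t n * ?E u v (x + a *\<^sub>R u + b *\<^sub>R v)"
        by (rule second_difference[OF assms(1,2) t box])
      show ?thesis using small[of a n b] ab by (intro exI[of _ "x + a *\<^sub>R u + b *\<^sub>R v"]) (auto simp: add.assoc)
    qed
    then show ?thesis by metis
  qed
  have ex': "\<exists>y. (\<forall>n. norm (y n - x) \<le> t n * c) \<and> (\<forall>n.
      f (x + t n *\<^sub>R v + t n *\<^sub>R u) - f (x + t n *\<^sub>R v) - f (x + t n *\<^sub>R u) + f x = t n * t n * ?E v u (y n))"
  proof -
    have "\<exists>y. norm (y - x) \<le> t n * c \<and>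
      f (x + t n *\<^sub>R v + t n *\<^sub>R u) - f (x + t n *\<^sub>R v) - f (x + t n *\<^sub>R u) + f x = t n * t n * ?E v u y" for n
    proof -
      have box': "x + a *\<^sub>R v + b *\<^sub>R u \<in> S" if "0 \<le> a" "a \<le> t n" "0 \<le> b" "b \<le> t n" for a b
        using box[OF that(3,4,1,2)] by (simp add: algebra_simps)
      obtain a b where ab: "0 < a" "a < t n" "0 < b" "b < t n"
        "f (x + t n *\<^sub>R v + t n *\<^sub>R u) - f (x + t n *\<^sub>R v) - f (x + t n *\<^sub>R u) + f x
           = t n * t n * ?E v u (x + a *\<^sub>R v + b *\<^sub>R u)"
        by (rule second_difference[OF assms(1,2) t box'])
      show ?thesis using small[of b n a] ab
        by (intro exI[of _ "x + a *\<^sub>R v + b *\<^sub>R u"]) (auto simp: add.assoc add.commute)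
    qed
    then show ?thesis by metis
  qed
  obtain y z where y: "\<And>n. norm (y n - x) \<le> t n * c" "\<And>n.
      f (x + t n *\<^sub>R u + t n *\<^sub>R v) - f (x + t n *\<^sub>R u) - f (x + t n *\<^sub>R v) + f x = t n * t n * ?E u v (y n)"
    and z: "\<And>n. norm (z n - x) \<le> t n * c" "\<And>n.
      f (x + t n *\<^sub>R v + t n *\<^sub>R u) - f (x + t n *\<^sub>R v) - f (x + t n *\<^sub>R u) + f x = t n * t n * ?E v u (z n)"
    using ex ex' by metis
  have eq: "?E u v (y n) = ?E v u (z n)" for n
  proof -
    have "t n * t n * ?E u v (y n) = t n * t n * ?E v u (z n)"
      using y(2)[of n] z(2)[of n] by (simp add: algebra_simps)
    then show ?thesis using t[of n] by simp
  qed
  have tc0: "(\<lambda>n. t n * c) \<longlonglongrightarrow> 0" using tendsto_mult_left_zero[OF t0] by simp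
  have lim: "w \<longlonglongrightarrow> x" if "\<And>n. norm (w n - x) \<le> t n * c" for w
  proof -
    have "(\<lambda>n. w n - x) \<longlonglongrightarrow> 0" by (rule Lim_null_comparison[OF _ tc0]) (use that in simp)
    then show ?thesis by (rule LIM_zero_cancel)
  qed
  have cont: "isCont (?E u v) x" for u v
    using smooth_on_imp_continuous_on[OF smooth_on_derivative[OF smooth_on_derivative[OF assms(2)]]]
      assms(1,3) continuous_on_eq_continuous_at by blast
  have "(\<lambda>n. ?E u v (y n)) \<longlonglongrightarrow> ?E u v x" "(\<lambda>n. ?E v u (z n)) \<longlonglongrightarrow> ?E v u x"
    using isCont_tendsto_compose[OF cont lim] y(1) z(1) by blast+
  then show ?thesis using eq LIMSEQ_unique by simp
qed

lemma second_derivative_symmetric: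
  fixes f :: "'a::euclidean_space \<Rightarrow> 'b::euclidean_space"
  assumes "open S" "smooth_on S f" "x \<in> S"
  shows "frechet_derivative (\<lambda>y. frechet_derivative f (at y) u) (at x) v =
         frechet_derivative (\<lambda>y. frechet_derivative f (at y) v) (at x) u"
proof (rule euclidean_eqI)
  fix b :: 'b
  have comp: "frechet_derivative (\<lambda>y. g y \<bullet> b) (at z) w = frechet_derivative g (at z) w \<bullet> b"
    if "smooth_on S g" "z \<in> S" for z w and g :: "'a \<Rightarrow> 'b"
    using frechet_derivative_at[OF has_derivative_inner_left[OF smooth_on_has_derivative[OF that]]] by metis
  have inner: "smooth_on S (\<lambda>y. g y \<bullet> b)" if "smooth_on S g" for g :: "'a \<Rightarrow> 'b"
    by (rule smooth_on_bounded_linear[OF assms(1) bounded_linear_inner_left that])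
  have *: "frechet_derivative (\<lambda>y. frechet_derivative f (at y) u) (at x) v \<bullet> b
     = frechet_derivative (\<lambda>y. frechet_derivative (\<lambda>z. f z \<bullet> b) (at y) u) (at x) v" for u v
    unfolding comp[OF smooth_on_derivative[OF assms(2)] assms(3), symmetric]
    by (rule fun_cong[OF frechet_derivative_transform_within_open[OF
       smooth_on_differentiable[OF _ assms(3)] assms(1) assms(3)]])
      (simp_all add: comp assms smooth_on_derivative inner)
  show "frechet_derivative (\<lambda>y. frechet_derivative f (at y) u) (at x) v \<bullet> b =
         frechet_derivative (\<lambda>y. frechet_derivative f (at y) v) (at x) u \<bullet> b"
    unfolding * by (rule second_derivative_symmetric_real[OF assms(1) inner[OF assms(2)] assms(3)])
qed

section \<open>Smooth bump functions\<close>

text \<open>The functions \<open>t \<mapsto> t\<^sup>-\<^sup>n exp (- 1 / t)\<close>, extended by zero to \<open>t \<le> 0\<close>.  The parameter \<open>n\<close> makes the span of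
  the family closed under differentiation, which gives smoothness of all members by one induction.\<close>

definition flat_exp :: "nat \<Rightarrow> real \<Rightarrow> real" where
  "flat_exp n t = (if t > 0 then inverse t ^ n / exp (inverse t) else 0)"

lemma flat_exp_tendsto_0: "(flat_exp n \<longlongrightarrow> 0) (at 0)"
proof (rule filterlim_split_at)
  have "((\<lambda>t::real. 0::real) \<longlongrightarrow> 0) (at_left 0)" by simp
  moreover have "\<forall>\<^sub>F t in at_left 0. (0::real) = flat_exp n t"
    by (simp add: flat_exp_def eventually_at_filter)
  ultimately show "(flat_exp n \<longlongrightarrow> 0) (at_left 0)" by (rule Lim_transform_eventually)
  have "((\<lambda>t::real. inverse t ^ n / exp (inverse t)) \<longlongrightarrow> 0) (at_right 0)"
    by (rule filterlim_compose[OF tendsto_power_div_exp_0 filterlim_inverse_at_top_right])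
  moreover have "\<forall>\<^sub>F t in at_right 0. inverse t ^ n / exp (inverse t) = flat_exp n t"
    by (simp add: flat_exp_def eventually_at_filter)
  ultimately show "(flat_exp n \<longlongrightarrow> 0) (at_right 0)" by (rule Lim_transform_eventually)
qed

lemma DERIV_flat_exp:
  "(flat_exp n has_real_derivative flat_exp (n + 2) t - real n * flat_exp (n + 1) t) (at t)"
proof -
  consider "t > 0" | "t < 0" | "t = 0" by linarith
  then show ?thesis
  proof cases
    case 1
    define s where "s = inverse t"
    have inv: "(inverse has_real_derivative - s\<^sup>2) (at t)"
      using DERIV_inverse[of t] 1 by (simp add: s_def power2_eq_square)
    have "((\<lambda>t. inverse t ^ n / exp (inverse t)) has_real_derivative
        (real n * (- s\<^sup>2 * s ^ (n - Suc 0)) * exp s - s ^ n * (exp s * - s\<^sup>2)) / (exp s * exp s)) (at t)"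
      unfolding s_def
      by (rule DERIV_divide[OF DERIV_power DERIV_fun_exp]) (use inv in \<open>simp_all add: s_def\<close>)
    moreover have "(real n * (- s\<^sup>2 * s ^ (n - Suc 0)) * exp s - s ^ n * (exp s * - s\<^sup>2)) / (exp s * exp s)
        = s ^ (n + 2) / exp s - real n * (s ^ (n + 1) / exp s)"
      by (cases n) (simp_all add: field_simps power2_eq_square)
    ultimately have "((\<lambda>t. inverse t ^ n / exp (inverse t)) has_real_derivative
        flat_exp (n + 2) t - real n * flat_exp (n + 1) t) (at t)"
      using 1 by (simp add: flat_exp_def s_def)
    then show ?thesis
      by (rule has_field_derivative_transform_within_open[of _ _ _ "{0<..}"]) (use 1 in \<open>auto simp: flat_exp_def\<close>)
  next
    case 2
    have "((\<lambda>t. 0) has_real_derivative flat_exp (n + 2) t - real n * flat_exp (n + 1) t) (at t)"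
      using 2 by (simp add: flat_exp_def)
    then show ?thesis
      by (rule has_field_derivative_transform_within_open[of _ _ _ "{..<0}"]) (use 2 in \<open>auto simp: flat_exp_def\<close>)
  next
    case 3
    \<comment> \<open>At the origin the difference quotient is again a member of the family.\<close>
    have "(\<lambda>h. (flat_exp n (0 + h) - flat_exp n 0) / h) = flat_exp (n + 1)"
      by (auto simp: fun_eq_iff flat_exp_def field_simps)
    then show ?thesis using flat_exp_tendsto_0[of "n + 1"] 3
      by (simp add: DERIV_def) (simp add: flat_exp_def)
  qed
qed

lemma smooth_on_flat_exp: "smooth_on UNIV (flat_exp n)"
  unfolding smooth_on_def
proof
  fix k show "Ck_on k (flat_exp n) UNIV"
  proof (induction k arbitrary: n)
    case 0
    show ?case using DERIV_continuous[OF DERIV_flat_exp]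
      by (simp add: continuous_on_eq_continuous_at)
  next
    case (Suc k)
    show ?case
    proof (rule Ck_on_SucI)
      show "(flat_exp n has_derivative (\<lambda>h. h *\<^sub>R (flat_exp (n + 2) t + (- real n) *\<^sub>R flat_exp (n + 1) t))) (at t)" for t
        using DERIV_flat_exp[of n t] unfolding has_field_derivative_def
        by (simp add: mult.commute[of _ "flat_exp (Suc (Suc n)) t - real n * flat_exp (Suc n) t"])
      show "Ck_on k (\<lambda>t. h *\<^sub>R (flat_exp (n + 2) t + (- real n) *\<^sub>R flat_exp (n + 1) t)) UNIV" for h
        by (intro Ck_on_bounded_linear[OF open_UNIV bounded_linear_scaleR_right] Ck_on_add open_UNIV Suc.IH)
    qed simp
  qed
qed

lemma smooth_bump:
  fixes x0 :: "'a::euclidean_space"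
  assumes "s > 0"
  obtains \<psi> :: "'a \<Rightarrow> real" where "smooth_on UNIV \<psi>" "\<psi> x0 = 1" "\<And>x. x \<notin> ball x0 s \<Longrightarrow> \<psi> x = 0"
proof
  \<comment> \<open>Positive exactly inside the ball, and equal to \<open>s\<^sup>2\<close> at its centre.\<close>
  let ?r = "\<lambda>x. s\<^sup>2 - (x - x0) \<bullet> (x - x0)"
  let ?\<psi> = "\<lambda>x. inverse (flat_exp 0 (s\<^sup>2)) *\<^sub>R flat_exp 0 (?r x)"
  have d: "smooth_on UNIV (\<lambda>x. x - x0)"
    by (intro smooth_on_diff smooth_on_ident smooth_on_const open_UNIV)
  have "smooth_on UNIV ?r"
    by (intro smooth_on_diff[OF open_UNIV smooth_on_const]
        smooth_on_bounded_bilinear[OF open_UNIV bounded_bilinear_inner] d)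
  then have "smooth_on UNIV (\<lambda>x. flat_exp 0 (?r x))"
    by (rule smooth_on_compose[OF open_UNIV open_UNIV UNIV_I _ smooth_on_flat_exp])
  then show "smooth_on UNIV ?\<psi>"
    by (rule smooth_on_bounded_linear[OF open_UNIV bounded_linear_scaleR_right])
  show "?\<psi> x0 = 1" using assms by (simp add: flat_exp_def)
  fix x assume "x \<notin> ball x0 s"
  then have "s \<le> norm (x - x0)" by (simp add: dist_norm norm_minus_commute)
  then have "s\<^sup>2 \<le> (x - x0) \<bullet> (x - x0)"
    using assms by (simp add: dot_square_norm power_mono)
  then show "?\<psi> x = 0" by (simp add: flat_exp_def)
qed

section \<open>Scalar products on a coordinate space\<close>

lemma linear_axis_expand:
  fixes L :: "real ^ 'n::finite \<Rightarrow> 'b::real_vector"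
  assumes "linear L"
  shows "L v = (\<Sum>i\<in>UNIV. (v $ i) *\<^sub>R L (axis i 1))"
proof -
  have "v = (\<Sum>i\<in>UNIV. (v $ i) *\<^sub>R axis i 1)"
    by (simp add: basis_expansion flip: scalar_mult_eq_scaleR)
  then have "L v = L (\<Sum>i\<in>UNIV. (v $ i) *\<^sub>R axis i 1)" by simp
  also have "\<dots> = (\<Sum>i\<in>UNIV. (v $ i) *\<^sub>R L (axis i 1))"
    using assms by (simp add: linear_sum linear_scale)
  finally show ?thesis .
qed

definition scalar_product :: "(real ^ 'n \<Rightarrow> real ^ 'n \<Rightarrow> real) \<Rightarrow> bool" where
  "scalar_product g \<longleftrightarrow> bilinear g \<and> (\<forall>u v. g u v = g v u) \<and> (\<forall>v. v \<noteq> 0 \<longrightarrow> g v v > 0)"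

text \<open>The map \<open>w \<mapsto> g w\<close> into the dual space is injective because \<open>g\<close> is positive definite, hence bijective.\<close>

lemma scalar_product_riesz:
  fixes g :: "real ^ 'n::finite \<Rightarrow> real ^ 'n \<Rightarrow> real"
  assumes g: "scalar_product g" and L: "linear L"
  shows "\<exists>!w. \<forall>v. g w v = L v"
proof -
  have bil: "bilinear g" and pos: "\<And>v. v \<noteq> 0 \<Longrightarrow> g v v > 0" using g by (auto simp: scalar_product_def)
  have l: "linear (g w)" and r: "linear (\<lambda>w. g w v)" for w v
    using bil by (simp_all add: bilinear_def)
  \<comment> \<open>The map to the dual space, with functionals given by their values on the coordinate vectors.\<close>
  let ?T = "\<lambda>w. \<chi> i. g w (axis i 1)"
  have T: "linear ?T"
    by (rule linearI) (simp_all add: vec_eq_iff linear_add[OF r] linear_scale[OF r])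
  have ext: "(\<forall>v. g w v = L' v) \<longleftrightarrow> (\<forall>i. g w (axis i 1) = L' (axis i 1))" if "linear L'" for w L'
  proof
    assume *: "\<forall>i. g w (axis i 1) = L' (axis i 1)"
    show "\<forall>v. g w v = L' v"
    proof
      fix v show "g w v = L' v"
        unfolding linear_axis_expand[OF that, of v] linear_axis_expand[OF l[of w], of v] using * by simp
    qed
  qed simp
  have "inj ?T"
  proof (subst linear_injective_0[OF T], intro allI impI)
    fix w assume "?T w = 0"
    then have "\<forall>i. g w (axis i 1) = (\<lambda>v. 0) (axis i 1)" by (simp add: vec_eq_iff)
    then have "g w w = 0" using ext[OF linear_zero, of w] by metis
    then show "w = 0" using pos[of w] by (metis less_irrefl)
  qed
  moreover from this have "surj ?T" using linear_injective_imp_surjective[OF T] by blast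
  ultimately have "\<exists>!w. (\<chi> i. L (axis i 1)) = ?T w" by (rule bij_pointE[OF bijI]) blast
  then show ?thesis unfolding ext[OF L] by (simp add: vec_eq_iff eq_commute)
qed

definition orthonormal_family :: "(real ^ 'n \<Rightarrow> real ^ 'n \<Rightarrow> real) \<Rightarrow> 'i set \<Rightarrow> ('i \<Rightarrow> real ^ 'n::finite) \<Rightarrow> bool" where
  "orthonormal_family g I e \<longleftrightarrow> (\<forall>i\<in>I. \<forall>j\<in>I. g (e i) (e j) = (if i = j then 1 else 0))"

context
  fixes g :: "real ^ 'n::finite \<Rightarrow> real ^ 'n \<Rightarrow> real"
  assumes g: "scalar_product g"
begin

lemma scalar_product_linear: "linear (g u)" "linear (\<lambda>u. g u v)"
  using g by (simp_all add: scalar_product_def bilinear_def)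

lemma scalar_product_sym: "g u v = g v u"
  using g by (simp add: scalar_product_def)

lemma scalar_product_pos: "v \<noteq> 0 \<Longrightarrow> g v v > 0"
  using g by (simp add: scalar_product_def)

lemma scalar_product_eq_0: "g v v = 0 \<Longrightarrow> v = 0"
  using scalar_product_pos[of v] by (cases "v = 0") auto

lemma orthonormal_sum:
  assumes "orthonormal_family g I e" "finite I" "j \<in> I"
  shows "g (\<Sum>i\<in>I. a i *\<^sub>R e i) (e j) = a j"
proof -
  have "g (\<Sum>i\<in>I. a i *\<^sub>R e i) (e j) = (\<Sum>i\<in>I. a i * g (e i) (e j))"
    by (simp add: linear_sum[OF scalar_product_linear(2)] linear_scale[OF scalar_product_linear(2)])
  also have "\<dots> = (\<Sum>i\<in>I. if i = j then a i else 0)"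
    using assms by (intro sum.cong) (auto simp: orthonormal_family_def)
  finally show ?thesis using assms by (simp add: sum.delta)
qed

lemma orthonormal_inj:
  assumes "orthonormal_family g I e" shows "inj_on e I"
  using assms unfolding orthonormal_family_def inj_on_def by (metis zero_neq_one)

lemma orthonormal_independent:
  assumes e: "orthonormal_family g I e" and I: "finite I"
  shows "independent (e ` I)"
proof
  assume "dependent (e ` I)"
  then obtain u where u: "\<exists>v\<in>e ` I. u v \<noteq> 0" "(\<Sum>v\<in>e ` I. u v *\<^sub>R v) = 0"
    using I by (auto simp: real_vector.dependent_finite)
  have "(\<Sum>i\<in>I. u (e i) *\<^sub>R e i) = 0"
    using u(2) by (simp add: sum.reindex[OF orthonormal_inj[OF e]])
  then have "u (e j) = 0" if "j \<in> I" for j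
    using orthonormal_sum[OF e I that, of "\<lambda>i. u (e i)"] linear_0[OF scalar_product_linear(2)] by simp
  then show False using u(1) by auto
qed

lemma dim_orthonormal:
  assumes e: "orthonormal_family g I e" and I: "finite I"
  shows "dim (span (e ` I)) = card I"
  using orthonormal_independent[OF assms] card_image[OF orthonormal_inj[OF e]]
  by (simp add: dim_eq_card_independent)

text \<open>One step of the Gram-Schmidt process: any vector outside the span of \<open>k\<close> orthonormal vectors yields one
  more after subtracting its projection.\<close>

lemma orthonormal_set_exists:
  "k \<le> CARD('n) \<Longrightarrow> \<exists>B. finite B \<and> card B = k \<and> orthonormal_family g B (\<lambda>v. v)"
proof (induction k)
  case 0
  show ?case by (rule exI[of _ "{}"]) (simp add: orthonormal_family_def)
next
  case (Suc k)
  then obtain B where B: "finite B" "card B = k" "orthonormal_family g B (\<lambda>v. v)" by auto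
  have "dim (span B) < CARD('n)" using dim_orthonormal[OF B(3,1)] B(2) Suc.prems by simp
  moreover have "dim (UNIV :: (real ^ 'n) set) = CARD('n)" by (simp add: dim_UNIV)
  ultimately have "span B \<noteq> UNIV" by (metis less_irrefl)
  then obtain w where w: "w \<notin> span B" by blast
  define v where "v = w - (\<Sum>b\<in>B. g w b *\<^sub>R b)"
  have "(\<Sum>b\<in>B. g w b *\<^sub>R b) \<in> span B" by (intro span_sum span_scale span_base)
  then have "v \<noteq> 0" using w unfolding v_def by auto
  then have pos: "g v v > 0" by (rule scalar_product_pos)
  have orth: "g v b = 0" if "b \<in> B" for b
    using orthonormal_sum[OF B(3,1) that, of "g w"]
    by (simp add: v_def linear_diff[OF scalar_product_linear(2)])
  define n where "n = (1 / sqrt (g v v)) *\<^sub>R v"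
  have nn: "g n n = 1"
    using pos by (simp add: n_def linear_scale[OF scalar_product_linear(2)] linear_scale[OF scalar_product_linear(1)])
  have nb: "g n b = 0" "g b n = 0" if "b \<in> B" for b
    using orth[OF that] scalar_product_sym[of b n]
    by (simp_all add: n_def linear_scale[OF scalar_product_linear(2)])
  have "n \<notin> B" using nn nb by fastforce
  then have "card (insert n B) = Suc k" using B by simp
  moreover have "orthonormal_family g (insert n B) (\<lambda>v. v)"
    using B(3) nn nb \<open>n \<notin> B\<close> by (auto simp: orthonormal_family_def)
  ultimately show ?case using B(1) by blast
qed

lemma orthonormal_frame_exists: "\<exists>e :: 'n \<Rightarrow> real ^ 'n. orthonormal_family g UNIV e"
proof -
  obtain B where B: "finite B" "card B = CARD('n)" "orthonormal_family g B (\<lambda>v. v)"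
    using orthonormal_set_exists[of "CARD('n)"] by auto
  then obtain e :: "'n \<Rightarrow> real ^ 'n" where "bij_betw e UNIV B"
    by (metis finite_same_card_bij finite_class.finite_UNIV)
  then have "inj e" "\<And>i. e i \<in> B" by (auto simp: bij_betw_def)
  then have "orthonormal_family g UNIV e"
    using B(3) by (auto simp: orthonormal_family_def inj_eq)
  then show ?thesis by blast
qed

lemma orthonormal_frame_parseval:
  assumes e: "orthonormal_family g (UNIV :: 'n set) e"
  shows "(\<Sum>i\<in>UNIV. g u (e i) * g v (e i)) = g u v"
proof -
  have "span (e ` UNIV) = UNIV"
    using dim_orthonormal[OF e finite] by (metis dim_eq_full DIM_cart DIM_real mult.right_neutral span_span)
  moreover have "subspace {y. g (u - (\<Sum>i\<in>UNIV. g u (e i) *\<^sub>R e i)) y = 0}"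
    by (rule linear_subspace_kernel[OF scalar_product_linear(1)])
  moreover have "e ` UNIV \<subseteq> {y. g (u - (\<Sum>i\<in>UNIV. g u (e i) *\<^sub>R e i)) y = 0}"
    using orthonormal_sum[OF e finite] by (auto simp: linear_diff[OF scalar_product_linear(2)])
  ultimately have "v \<in> {y. g (u - (\<Sum>i\<in>UNIV. g u (e i) *\<^sub>R e i)) y = 0}"
    using span_minimal by blast
  then have "g u v = (\<Sum>i\<in>UNIV. g u (e i) * g (e i) v)"
    by (simp add: linear_diff[OF scalar_product_linear(2)] linear_sum[OF scalar_product_linear(2)]
        linear_scale[OF scalar_product_linear(2)])
  then show ?thesis by (simp add: scalar_product_sym[of _ v])
qed

text \<open>The span \<open>E\<close> of the family meets \<open>T\<close> only in \<open>0\<close>, so \<open>E + T\<close> is the whole space for dimension reasons.  The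
  \<open>E\<close>-part of a vector orthogonal to the family is orthogonal to itself.\<close>

lemma orthogonal_complement_eq:
  assumes e: "orthonormal_family g I e" and I: "finite I" and T: "subspace T"
    and dim: "dim T + card I = CARD('n)"
    and orth: "\<And>i t. i \<in> I \<Longrightarrow> t \<in> T \<Longrightarrow> g (e i) t = 0"
    and v: "\<And>i. i \<in> I \<Longrightarrow> g (e i) v = 0"
  shows "v \<in> T"
proof -
  let ?E = "span (e ` I)"
  have E: "g x t = 0" if "x \<in> ?E" "\<And>i. i \<in> I \<Longrightarrow> g (e i) t = 0" for x t
  proof -
    have "subspace {x. g x t = 0}" by (rule linear_subspace_kernel[OF scalar_product_linear(2)])
    then have "?E \<subseteq> {x. g x t = 0}" using that(2) by (intro span_minimal) auto
    then show ?thesis using that(1) by auto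
  qed
  have "?E \<inter> T = {0}"
    using E orth scalar_product_eq_0 subspace_0[OF T] span_0 by blast
  then have "dim {x + y |x y. x \<in> ?E \<and> y \<in> T} = DIM(real ^ 'n)"
    using dim_sums_Int[OF subspace_span T, of "e ` I"] dim_orthonormal[OF e I] dim by simp
  then have "span {x + y |x y. x \<in> ?E \<and> y \<in> T} = UNIV" by (simp only: dim_eq_full)
  moreover have "span {x + y |x y. x \<in> ?E \<and> y \<in> T} = {x + y |x y. x \<in> ?E \<and> y \<in> T}"
    by (rule iffD2[OF span_eq_iff subspace_sums[OF subspace_span T]])
  ultimately have "{x + y |x y. x \<in> ?E \<and> y \<in> T} = UNIV" by (simp only:)
  then obtain x t where xt: "x \<in> ?E" "t \<in> T" "v = x + t" by blast
  have "g (e i) x = 0" if "i \<in> I" for i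
    using v[OF that] orth[OF that xt(2)] by (simp add: xt(3) linear_add[OF scalar_product_linear(1)])
  then have "g x x = 0" using E[OF xt(1)] by blast
  then have "x = 0" by (rule scalar_product_eq_0)
  then show ?thesis using xt by simp
qed

end

section \<open>Charts, transition maps and vector fields\<close>

text \<open>The Jacobian of the change of coordinates from \<open>d\<close> to \<open>c\<close>.  Both \<open>to_chart\<close> and \<open>from_chart\<close> are instances,
  so that all their properties reduce to the chain rule \<open>transition_transition\<close>.\<close>

definition transition :: "('a, 'n::finite) chart \<Rightarrow> ('a, 'n) chart \<Rightarrow> real ^ 'n \<Rightarrow> real ^ 'n \<Rightarrow> real ^ 'n" where
  "transition d c x = frechet_derivative (snd c \<circ> chart_inv d) (at x)"

lemma is_chart_inv:
  assumes "is_chart c"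
  shows "p \<in> fst c \<Longrightarrow> chart_inv c (snd c p) = p"
    and "x \<in> snd c ` fst c \<Longrightarrow> snd c (chart_inv c x) = x"
    and "x \<in> snd c ` fst c \<Longrightarrow> chart_inv c x \<in> fst c"
    and "p \<in> fst c \<Longrightarrow> snd c p \<in> snd c ` fst c"
  using assms unfolding is_chart_def homeomorphism_def by auto

lemma open_chart_image:
  assumes "is_chart c" "open W"
  shows "open (snd c ` (fst c \<inter> W))"
proof -
  have "snd c ` (fst c \<inter> W) = snd c ` fst c \<inter> chart_inv c -` W"
    using is_chart_inv[OF assms(1)] by auto
  then show ?thesis
    using assms continuous_open_preimage[of "snd c ` fst c" "chart_inv c" W]
    unfolding is_chart_def homeomorphism_def by auto
qed

lemma linear_one_form:
  assumes "alternating 1 \<omega>" shows "linear (\<lambda>v. \<omega> [v])"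
proof -
  have "linear (\<lambda>v. \<omega> ([undefined][0 := v]))"
    using assms unfolding alternating_def by (metis One_nat_def length_Cons list.size(3) zero_less_one)
  then show ?thesis by simp
qed

lemma metric_scalar_product: "riemannian_metric M \<Longrightarrow> scalar_product (metric M p)"
  by (simp add: riemannian_metric_def scalar_product_def)

lemma metric_sharp:
  fixes M :: "('a, 'n::finite) foliated_manifold"
  assumes "riemannian_metric M" "differential_form M 1 \<alpha>"
  shows "metric M p (sharp M \<alpha> p) v = \<alpha> p [v]"
proof -
  have "\<exists>!w. \<forall>v. metric M p w v = \<alpha> p [v]"
    using assms(2) by (intro scalar_product_riesz metric_scalar_product assms(1) linear_one_form)
      (simp add: differential_form_def)
  from theI'[OF this] show ?thesis by (simp add: sharp_def)
qed

context
  fixes M :: "('a::t2_space, 'n::finite) foliated_manifold"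
  assumes atlas: "foliated_atlas M"
begin

lemma charts_is_chart: "c \<in> charts M \<Longrightarrow> is_chart c"
  using atlas by (simp add: foliated_atlas_def)

lemma open_chart_domain: "c \<in> charts M \<Longrightarrow> open (fst c)"
  using charts_is_chart is_chart_def by blast

lemma chart_at_in: "chart_at M p \<in> charts M" "p \<in> fst (chart_at M p)"
proof -
  have "\<exists>c. c \<in> charts M \<and> p \<in> fst c" using atlas unfolding foliated_atlas_def by blast
  from someI_ex[OF this] show "chart_at M p \<in> charts M" "p \<in> fst (chart_at M p)"
    by (simp_all add: chart_at_def)
qed

lemma open_overlap: "c \<in> charts M \<Longrightarrow> d \<in> charts M \<Longrightarrow> open (snd c ` (fst c \<inter> fst d))"
  using open_chart_image charts_is_chart open_chart_domain by blast

lemma open_chart_range: "c \<in> charts M \<Longrightarrow> open (snd c ` fst c)"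
  using charts_is_chart is_chart_def by blast

lemma transition_smooth:
  "c \<in> charts M \<Longrightarrow> d \<in> charts M \<Longrightarrow> smooth_on (snd c ` (fst c \<inter> fst d)) (snd d \<circ> chart_inv c)"
  using atlas by (simp add: foliated_atlas_def)

lemma transition_has_derivative:
  assumes "c \<in> charts M" "d \<in> charts M" "p \<in> fst c" "p \<in> fst d"
  shows "((snd d \<circ> chart_inv c) has_derivative transition c d (snd c p)) (at (snd c p))"
  unfolding transition_def
  by (rule smooth_on_has_derivative[OF transition_smooth[OF assms(1,2)]]) (use assms in auto)

lemma linear_transition:
  assumes "c \<in> charts M" "d \<in> charts M" "p \<in> fst c" "p \<in> fst d"
  shows "linear (transition c d (snd c p))"
  using transition_has_derivative[OF assms] has_derivative_linear by blast

lemma transition_transition: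
  assumes "c \<in> charts M" "d \<in> charts M" "e \<in> charts M" "p \<in> fst c" "p \<in> fst d" "p \<in> fst e"
  shows "transition d e (snd d p) (transition c d (snd c p) v) = transition c e (snd c p) v"
proof -
  note inv = is_chart_inv[OF charts_is_chart]
  have "((snd e \<circ> chart_inv d) \<circ> (snd d \<circ> chart_inv c) has_derivative
      transition d e (snd d p) \<circ> transition c d (snd c p)) (at (snd c p))"
    using diff_chain_at[OF transition_has_derivative[OF assms(1,2,4,5)],
        of "snd e \<circ> chart_inv d" "transition d e (snd d p)"]
      transition_has_derivative[OF assms(2,3,5,6)] assms by (simp add: inv)
  then have "(snd e \<circ> chart_inv c has_derivative
      transition d e (snd d p) \<circ> transition c d (snd c p)) (at (snd c p))"
    by (rule has_derivative_transform_within_open[OF _ open_overlap[OF assms(1,2)]])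
      (use assms in \<open>auto simp: inv\<close>)
  then show ?thesis
    using has_derivative_unique[OF transition_has_derivative[OF assms(1,3,4,6)]] by (metis comp_apply)
qed

lemma transition_self:
  assumes "c \<in> charts M" "p \<in> fst c"
  shows "transition c c (snd c p) v = v"
proof -
  have "(snd c \<circ> chart_inv c has_derivative (\<lambda>v. v)) (at (snd c p))"
    by (rule has_derivative_transform_within_open[OF has_derivative_ident open_chart_range[OF assms(1)]])
      (use assms in \<open>auto simp: is_chart_inv[OF charts_is_chart]\<close>)
  then show ?thesis
    using has_derivative_unique[OF transition_has_derivative[OF assms(1,1,2,2)]] by metis
qed

lemma to_chart_eq: "to_chart M c p = transition (chart_at M p) c (snd (chart_at M p) p)"
  by (simp add: to_chart_def transition_def coord_at_def)

lemma from_chart_eq: "from_chart M c p = transition c (chart_at M p) (snd c p)"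
  by (simp add: from_chart_def transition_def)

lemma linear_to_chart: "c \<in> charts M \<Longrightarrow> p \<in> fst c \<Longrightarrow> linear (to_chart M c p)"
  unfolding to_chart_eq by (intro linear_transition chart_at_in)

lemma linear_from_chart: "c \<in> charts M \<Longrightarrow> p \<in> fst c \<Longrightarrow> linear (from_chart M c p)"
  unfolding from_chart_eq by (intro linear_transition chart_at_in)

lemma to_chart_from_chart:
  "c \<in> charts M \<Longrightarrow> d \<in> charts M \<Longrightarrow> p \<in> fst c \<Longrightarrow> p \<in> fst d \<Longrightarrow>
   to_chart M d p (from_chart M c p v) = transition c d (snd c p) v"
  by (simp add: to_chart_eq from_chart_eq transition_transition chart_at_in)

lemma to_chart_from_chart_self: "c \<in> charts M \<Longrightarrow> p \<in> fst c \<Longrightarrow> to_chart M c p (from_chart M c p v) = v"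
  by (simp add: to_chart_from_chart transition_self)

lemma from_chart_to_chart: "c \<in> charts M \<Longrightarrow> p \<in> fst c \<Longrightarrow> from_chart M c p (to_chart M c p v) = v"
  by (simp add: to_chart_eq from_chart_eq transition_transition transition_self chart_at_in)

lemma transition_to_chart:
  "c \<in> charts M \<Longrightarrow> d \<in> charts M \<Longrightarrow> p \<in> fst c \<Longrightarrow> p \<in> fst d \<Longrightarrow>
   transition c d (snd c p) (to_chart M c p v) = to_chart M d p v"
  by (simp add: to_chart_eq transition_transition chart_at_in)

lemma to_chart_chart_at: "to_chart M (chart_at M p) p v = v"
  by (simp add: to_chart_eq transition_self chart_at_in)

lemma from_chart_chart_at: "from_chart M (chart_at M p) p v = v"
  by (simp add: from_chart_eq transition_self chart_at_in)

lemma vec_rep_at: "c \<in> charts M \<Longrightarrow> p \<in> fst c \<Longrightarrow> vec_rep M c X (snd c p) = to_chart M c p (X p)"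
  by (simp add: vec_rep_def is_chart_inv[OF charts_is_chart])

text \<open>The transformation law of vector fields: an identity of functions near a point, hence one that can be differentiated.\<close>

lemma vec_rep_transition:
  assumes "c \<in> charts M" "d \<in> charts M" "x \<in> snd c ` (fst c \<inter> fst d)"
  shows "vec_rep M d X ((snd d \<circ> chart_inv c) x) = transition c d x (vec_rep M c X x)"
  using assms
  by (auto simp: vec_rep_at is_chart_inv[OF charts_is_chart] transition_to_chart)

lemma form_rep_at: "c \<in> charts M \<Longrightarrow> p \<in> fst c \<Longrightarrow> form_rep M c \<omega> (snd c p) us = \<omega> p (map (from_chart M c p) us)"
  by (simp add: form_rep_def is_chart_inv[OF charts_is_chart])

lemma coord_at_in: "coord_at M p \<in> snd (chart_at M p) ` fst (chart_at M p)"
  by (simp add: coord_at_def chart_at_in)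

lemma vec_rep_coord_at: "vec_rep M (chart_at M p) X (coord_at M p) = X p"
  by (simp add: coord_at_def vec_rep_at chart_at_in to_chart_chart_at)

lemma smooth_vec_rep: "vector_field M X \<Longrightarrow> c \<in> charts M \<Longrightarrow> smooth_on (snd c ` fst c) (vec_rep M c X)"
  by (simp add: vector_field_on_def)

section \<open>The bracket of vector fields\<close>

text \<open>Differentiating the transformation law \<open>Y\<^sub>d(\<phi>(x)) = D\<phi>(x) Y\<^sub>c(x)\<close> in the direction \<open>X\<^sub>c\<close>.
  The last summand, a second derivative of the transition map \<open>\<phi>\<close>, shows that the derivative of the components
  of \<open>Y\<close> along \<open>X\<close> is not a vector field by itself.\<close>

lemma derivative_vec_rep_transition:
  assumes X: "vector_field M X" and Y: "vector_field M Y" and c: "c \<in> charts M" "p \<in> fst c"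
    and d: "d \<in> charts M" "p \<in> fst d"
  shows "frechet_derivative (vec_rep M d Y) (at (snd d p)) (vec_rep M d X (snd d p)) =
    transition c d (snd c p) (frechet_derivative (vec_rep M c Y) (at (snd c p)) (vec_rep M c X (snd c p))) +
    frechet_derivative (\<lambda>x. transition c d x (vec_rep M c Y (snd c p))) (at (snd c p)) (vec_rep M c X (snd c p))"
proof -
  let ?U = "snd c ` (fst c \<inter> fst d)"
  have U: "open ?U" "snd c p \<in> ?U" using open_overlap c d by auto
  have inv: "chart_inv c (snd c p) = p" using is_chart_inv[OF charts_is_chart] c by simp
  have 1: "(vec_rep M d Y \<circ> (snd d \<circ> chart_inv c) has_derivative
      frechet_derivative (vec_rep M d Y) (at (snd d p)) \<circ> transition c d (snd c p)) (at (snd c p))"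
    using smooth_on_has_derivative[OF smooth_vec_rep[OF Y d(1)], of "snd d p"] d
    by (intro diff_chain_at transition_has_derivative c d) (simp add: inv)
  have der: "((\<lambda>x. transition c d x (vec_rep M c Y x)) has_derivative
      frechet_derivative (vec_rep M d Y) (at (snd d p)) \<circ> transition c d (snd c p)) (at (snd c p))"
    by (rule has_derivative_transform_within_open[OF 1 U]) (simp add: vec_rep_transition[OF c(1) d(1), symmetric])
  have "frechet_derivative (vec_rep M d Y) (at (snd d p)) (transition c d (snd c p) (vec_rep M c X (snd c p)))
     = frechet_derivative (\<lambda>x. transition c d x (vec_rep M c Y x)) (at (snd c p)) (vec_rep M c X (snd c p))"
    unfolding frechet_derivative_at[OF der, symmetric] by simp
  also have "\<dots> = transition c d (snd c p) (frechet_derivative (vec_rep M c Y) (at (snd c p)) (vec_rep M c X (snd c p))) +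
    frechet_derivative (\<lambda>x. transition c d x (vec_rep M c Y (snd c p))) (at (snd c p)) (vec_rep M c X (snd c p))"
    unfolding transition_def
    by (rule frechet_derivative_family_apply[OF U(1) smooth_on_derivative[OF transition_smooth[OF c(1) d(1)]]
          linear_smooth_derivative[OF transition_smooth[OF c(1) d(1)]]
          smooth_on_subset[OF smooth_vec_rep[OF Y c(1)]] U(2)]) auto
  finally show ?thesis
    using vec_rep_transition[OF c(1) d(1) U(2), of X] by (simp add: inv)
qed

text \<open>The coordinate formula for the bracket holds in every chart, and not only in the one chosen at \<open>p\<close>:
  the second derivatives of the transition map are symmetric and cancel in the difference.\<close>

lemma to_chart_bracket:
  assumes "vector_field M X" "vector_field M Y" "d \<in> charts M" "p \<in> fst d"
  shows "to_chart M d p (bracket M X Y p) =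
    frechet_derivative (vec_rep M d Y) (at (snd d p)) (vec_rep M d X (snd d p)) -
    frechet_derivative (vec_rep M d X) (at (snd d p)) (vec_rep M d Y (snd d p))"
proof -
  let ?c = "chart_at M p"
  note c = chart_at_in[of p]
  have U: "open (snd ?c ` (fst ?c \<inter> fst d))" "snd ?c p \<in> snd ?c ` (fst ?c \<inter> fst d)"
    using open_overlap c assms by auto
  have sym: "frechet_derivative (\<lambda>x. transition ?c d x u) (at (snd ?c p)) v =
      frechet_derivative (\<lambda>x. transition ?c d x v) (at (snd ?c p)) u" for u v
    unfolding transition_def
    by (rule second_derivative_symmetric[OF U(1) transition_smooth[OF c(1) assms(3)] U(2)])
  have lin: "linear (transition ?c d (snd ?c p))" by (rule linear_transition[OF c(1) assms(3) c(2) assms(4)])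
  have X: "X p = vec_rep M ?c X (snd ?c p)" for X
    using vec_rep_coord_at by (simp add: coord_at_def)
  show ?thesis
    unfolding derivative_vec_rep_transition[OF assms(1,2) c assms(3,4)]
      derivative_vec_rep_transition[OF assms(2,1) c assms(3,4)]
      sym[of "vec_rep M ?c Y (snd ?c p)" "vec_rep M ?c X (snd ?c p)"]
    by (simp add: to_chart_eq bracket_def comp_deriv_def coord_at_def linear_diff[OF lin] X[of X] X[of Y])
qed

lemma vector_field_bracket:
  assumes "vector_field M X" "vector_field M Y"
  shows "vector_field M (bracket M X Y)"
  unfolding vector_field_on_def
proof
  fix d assume d: "d \<in> charts M"
  let ?D = "\<lambda>X Y x. frechet_derivative (vec_rep M d Y) (at x) (vec_rep M d X x)"
  have "smooth_on (snd d ` fst d) (\<lambda>x. ?D X Y x - ?D Y X x)"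
    by (intro smooth_on_diff smooth_on_derivative_apply open_chart_range smooth_vec_rep assms d)
  then have "smooth_on (snd d ` fst d) (vec_rep M d (bracket M X Y))"
    by (rule smooth_on_cong[OF open_chart_range[OF d], rotated])
      (use to_chart_bracket[OF assms d] d in \<open>auto simp: vec_rep_at\<close>)
  then show "smooth_on (snd d ` (fst d \<inter> UNIV)) (vec_rep M d (bracket M X Y))" by simp
qed

section \<open>Sections of the tangent bundle of the foliation\<close>

lemma TF_iff: "v \<in> TF M \<longleftrightarrow> (\<forall>i\<in>transv M. v $ i = 0)"
  by (simp add: TF_def)

text \<open>The transverse coordinates in \<open>d\<close> are locally functions of the transverse coordinates in \<open>c\<close>, hence constant
  along a line in a leafwise direction.\<close>

lemma transition_TF:
  assumes "c \<in> charts M" "d \<in> charts M" "p \<in> fst c" "p \<in> fst d" "v \<in> TF M"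
  shows "transition c d (snd c p) v \<in> TF M"
  unfolding TF_iff
proof
  fix i assume i: "i \<in> transv M"
  have "\<exists>W. open W \<and> p \<in> W \<and> W \<subseteq> fst c \<inter> fst d \<and>
           (\<forall>x\<in>W. \<forall>y\<in>W. (\<forall>i\<in>transv M. snd c x $ i = snd c y $ i) \<longrightarrow>
                         (\<forall>i\<in>transv M. snd d x $ i = snd d y $ i))"
    using atlas assms unfolding foliated_atlas_def by blast
  then obtain W where W: "open W" "p \<in> W" "W \<subseteq> fst c \<inter> fst d"
    "\<And>x y. x \<in> W \<Longrightarrow> y \<in> W \<Longrightarrow> (\<forall>i\<in>transv M. snd c x $ i = snd c y $ i) \<Longrightarrow> snd d x $ i = snd d y $ i"
    using i by metis
  note inv = is_chart_inv[OF charts_is_chart]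
  let ?\<gamma> = "\<lambda>t::real. snd c p + t *\<^sub>R v"
  have U: "open (snd c ` (fst c \<inter> W))" by (rule open_chart_image[OF charts_is_chart[OF assms(1)] W(1)])
  have V: "open (?\<gamma> -` (snd c ` (fst c \<inter> W)))"
    by (intro continuous_open_vimage U) (auto intro!: continuous_intros)
  have "(?\<gamma> has_derivative (\<lambda>t. t *\<^sub>R v)) (at 0)" by (auto intro!: derivative_eq_intros)
  moreover have "(snd d \<circ> chart_inv c has_derivative transition c d (snd c p)) (at (?\<gamma> 0))"
    using transition_has_derivative[OF assms(1-4)] by simp
  ultimately have "((\<lambda>t. (snd d \<circ> chart_inv c) (?\<gamma> t)) has_derivative (\<lambda>t. transition c d (snd c p) (t *\<^sub>R v))) (at 0)"
    by (rule has_derivative_compose)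
  then have "((\<lambda>t. (snd d \<circ> chart_inv c) (?\<gamma> t) $ i) has_derivative (\<lambda>t. transition c d (snd c p) (t *\<^sub>R v) $ i)) (at 0)"
    by (rule bounded_linear.has_derivative[OF bounded_linear_vec_nth])
  then have "((\<lambda>t. snd d p $ i) has_derivative (\<lambda>t. transition c d (snd c p) (t *\<^sub>R v) $ i)) (at 0)"
  proof (rule has_derivative_transform_within_open[OF _ V])
    show "0 \<in> ?\<gamma> -` (snd c ` (fst c \<inter> W))" using W assms by auto
    fix t assume "t \<in> ?\<gamma> -` (snd c ` (fst c \<inter> W))"
    then obtain q where q: "q \<in> fst c" "q \<in> W" "?\<gamma> t = snd c q" by auto
    have "snd d q $ i = snd d p $ i"
    proof (rule W(4)[OF q(2) W(2)], rule ballI)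
      fix j assume "j \<in> transv M"
      then have "?\<gamma> t $ j = snd c p $ j" using assms(5) by (simp add: TF_iff)
      then show "snd c q $ j = snd c p $ j" using q(3) by simp
    qed
    then show "(snd d \<circ> chart_inv c) (?\<gamma> t) $ i = snd d p $ i"
      using q(3) inv(1)[OF assms(1) q(1)] by simp
  qed
  then have "(\<lambda>t. transition c d (snd c p) (t *\<^sub>R v) $ i) = (\<lambda>t. 0)"
    using has_derivative_unique[OF has_derivative_const] by metis
  from fun_cong[OF this, of 1] show "transition c d (snd c p) v $ i = 0" by simp
qed

text \<open>In the coordinates around \<open>p\<close> the section is \<open>\<psi> v\<close> for a bump function \<open>\<psi>\<close>; transition maps keep it tangent
  to the leaves at points where the tangent space is identified by another chart.\<close>

lemma sections_TF_through:
  assumes v: "v \<in> TF M"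
  obtains X where "X \<in> sections_TF M" "X p = v"
proof -
  let ?c = "chart_at M p"
  note c = chart_at_in[of p]
  note inv = is_chart_inv[OF charts_is_chart]
  have "open (snd ?c ` fst ?c)" "snd ?c p \<in> snd ?c ` fst ?c" using open_chart_range[OF c(1)] c by auto
  then obtain s where s: "s > 0" "cball (snd ?c p) s \<subseteq> snd ?c ` fst ?c" by (meson open_contains_cball)
  obtain \<psi> :: "real ^ 'n \<Rightarrow> real" where \<psi>: "smooth_on UNIV \<psi>" "\<psi> (snd ?c p) = 1"
    "\<And>x. x \<notin> ball (snd ?c p) s \<Longrightarrow> \<psi> x = 0" using smooth_bump[OF s(1)] by metis
  define X where "X q = (if q \<in> fst ?c then from_chart M ?c q (\<psi> (snd ?c q) *\<^sub>R v) else 0)" for q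
  \<comment> \<open>The section vanishes off this compact set, which is closed because the manifold is Hausdorff.\<close>
  let ?K = "chart_inv ?c ` cball (snd ?c p) s"
  have "continuous_on (snd ?c ` fst ?c) (chart_inv ?c)"
    using charts_is_chart[OF c(1)] by (simp add: is_chart_def homeomorphism_def)
  then have "compact ?K" by (intro compact_continuous_image continuous_on_subset[OF _ s(2)] compact_cball)
  then have K: "closed ?K" by (rule compact_imp_closed)
  have X0: "X q = 0" if "q \<notin> ?K" for q
  proof (cases "q \<in> fst ?c")
    case True
    have "snd ?c q \<notin> cball (snd ?c p) s"
      using that inv(1)[OF c(1) True] by (metis imageI)
    then have "\<psi> (snd ?c q) = 0" using \<psi>(3) by auto
    then show ?thesis using linear_0[OF linear_from_chart[OF c(1) True]] by (simp add: X_def)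
  qed (simp add: X_def)
  have "smooth_on (snd d ` fst d) (vec_rep M d X)" if d: "d \<in> charts M" for d
  proof (rule smooth_on_local)
    fix x assume "x \<in> snd d ` fst d"
    then obtain q where q: "q \<in> fst d" "x = snd d q" by auto
    show "\<exists>U. open U \<and> x \<in> U \<and> smooth_on U (vec_rep M d X)"
    proof (cases "q \<in> fst ?c")
      case True
      let ?U = "snd d ` (fst d \<inter> fst ?c)" and ?V = "snd ?c ` (fst ?c \<inter> fst d)"
      let ?\<phi> = "snd ?c \<circ> chart_inv d"
      have U: "open ?U" and V: "open ?V" using open_overlap c d by auto
      have sm: "smooth_on ?V (\<lambda>y. transition ?c d y (\<psi> y *\<^sub>R v))"
        unfolding transition_def
        by (intro smooth_on_derivative_apply V transition_smooth[OF c(1) d] smooth_on_scaleR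
            smooth_on_const smooth_on_subset[OF \<psi>(1)]) simp
      have "smooth_on ?U (\<lambda>x. transition ?c d (?\<phi> x) (\<psi> (?\<phi> x) *\<^sub>R v))"
        by (rule smooth_on_compose[OF U V _ transition_smooth[OF d c(1)] sm]) (auto simp: inv d)
      then have "smooth_on ?U (vec_rep M d X)"
        by (rule smooth_on_cong[OF U, rotated])
          (auto simp: vec_rep_at[OF d] inv d X_def to_chart_from_chart[OF c(1) d])
      then show ?thesis using U q True by blast
    next
      case False
      let ?U = "snd d ` (fst d \<inter> - ?K)"
      have U: "open ?U" using open_chart_image[OF charts_is_chart[OF d]] K by blast
      have "vec_rep M d X y = 0" if "y \<in> ?U" for y
        using that X0 linear_0[OF linear_to_chart[OF d]] by (auto simp: vec_rep_at[OF d])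
      then have "smooth_on ?U (vec_rep M d X)"
        using smooth_on_cong[OF U _ smooth_on_const[of _ 0], of "vec_rep M d X"] by simp
      moreover have "q \<notin> ?K" using False inv(3)[OF c(1)] s(2) by blast
      ultimately show ?thesis using U q by blast
    qed
  qed
  then have "vector_field M X" by (simp add: vector_field_on_def)
  moreover have "X q \<in> TF M" for q
  proof (cases "q \<in> fst ?c")
    case True
    then show ?thesis using v
      by (auto simp: X_def from_chart_eq TF_iff
          intro!: transition_TF[OF c(1) chart_at_in(1) _ chart_at_in(2), unfolded TF_iff, rule_format])
  qed (simp add: X_def TF_iff)
  ultimately have "X \<in> sections_TF M" by (simp add: sections_TF_def)
  moreover have "X p = v" using c by (simp add: X_def \<psi>(2) from_chart_chart_at)
  ultimately show ?thesis using that by blast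
qed

section \<open>Closed and basic one-forms\<close>

text \<open>Basic forms vanish on global sections of \<open>TF\<close> by definition, and such a section passes through every vector.\<close>

lemma basic_one_form_TF:
  assumes "basic_form M 1 \<alpha>" "v \<in> TF M" shows "\<alpha> p [v] = 0"
proof -
  obtain X where X: "X \<in> sections_TF M" "X p = v" using sections_TF_through[OF assms(2)] .
  then have "int_prod X \<alpha> = zero_form" using assms(1) by (simp add: basic_form_def)
  from fun_cong[OF fun_cong[OF this], of p "[]"] show ?thesis by (simp add: int_prod_def X)
qed

text \<open>For constant \<open>\<alpha>(X)\<close> and \<open>\<alpha>(Y)\<close> the formula \<open>d\<alpha>(X, Y) = X(\<alpha>(Y)) - Y(\<alpha>(X)) - \<alpha>([X, Y])\<close> has only one term on the
  right.  In coordinates, \<open>0 = X(\<alpha>(Y)) = \<alpha>(DY X) + (D\<alpha> X)(Y)\<close>, and the antisymmetric part of the second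
  summand is \<open>d\<alpha>(X, Y)\<close>.\<close>

lemma closed_one_form_bracket:
  assumes \<alpha>: "differential_form M 1 \<alpha>" "ext_deriv M \<alpha> = zero_form"
    and X: "vector_field M X" "\<And>p. \<alpha> p [X p] = a" and Y: "vector_field M Y" "\<And>p. \<alpha> p [Y p] = b"
  shows "\<alpha> p [bracket M X Y p] = 0"
proof -
  let ?c = "chart_at M p" and ?x = "coord_at M p"
  note c = chart_at_in[of p]
  let ?S = "snd ?c ` fst ?c"
  have S: "open ?S" "?x \<in> ?S" using open_chart_range[OF c(1)] coord_at_in by auto
  \<comment> \<open>The components of the form in the chart, as a smooth family of linear functionals.\<close>
  let ?F = "\<lambda>x v. form_rep M ?c \<alpha> x [v]"
  have lin: "linear (\<lambda>v. \<alpha> q [v])" for q using linear_one_form \<alpha>(1) by (auto simp: differential_form_def)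
  have F: "smooth_on ?S (\<lambda>x. ?F x v)" for v using \<alpha>(1) c by (simp add: differential_form_def)
  have Flin: "linear (?F x)" if x: "x \<in> ?S" for x
  proof -
    obtain q where q: "q \<in> fst ?c" "x = snd ?c q" using x by blast
    have "?F x = (\<lambda>v. \<alpha> q [v]) \<circ> from_chart M ?c q" by (simp add: q form_rep_at[OF c(1)] fun_eq_iff)
    then show ?thesis using linear_compose[OF linear_from_chart[OF c(1) q(1)] lin] by simp
  qed
  have Fp: "?F ?x v = \<alpha> p [v]" for v
    by (simp add: coord_at_def form_rep_at[OF c] from_chart_chart_at)
  have key: "\<alpha> p [comp_deriv M U V p] + frechet_derivative (\<lambda>x. ?F x (V p)) (at ?x) (U p) = 0"
    if V: "vector_field M V" "\<And>p. \<alpha> p [V p] = k" for U V k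
  proof -
    have "frechet_derivative (\<lambda>x. ?F x (vec_rep M ?c V x)) (at ?x) (U p) = 
      ?F ?x (comp_deriv M U V p) + frechet_derivative (\<lambda>x. ?F x (vec_rep M ?c V ?x)) (at ?x) (U p)"
      unfolding comp_deriv_def
      by (rule frechet_derivative_family_apply[OF S(1) F Flin smooth_vec_rep[OF V(1) c(1)] S(2)])
    moreover have const: "?F x (vec_rep M ?c V x) = k" if "x \<in> ?S" for x
      using that V(2) by (auto simp: form_rep_at[OF c(1)] vec_rep_at[OF c(1)] from_chart_to_chart[OF c(1)])
    have "frechet_derivative (\<lambda>x. k) (at ?x) = frechet_derivative (\<lambda>x. ?F x (vec_rep M ?c V x)) (at ?x)"
      by (rule frechet_derivative_transform_within_open[OF differentiable_const S]) (simp only: const)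
    from fun_cong[OF this, of "U p"]
    have "frechet_derivative (\<lambda>x. ?F x (vec_rep M ?c V x)) (at ?x) (U p) = 0" by simp
    ultimately show ?thesis by (simp only: Fp vec_rep_coord_at)
  qed
  have "ext_deriv M \<alpha> p [X p, Y p] = 0" using \<alpha>(2) by simp
  then have "frechet_derivative (\<lambda>x. ?F x (Y p)) (at ?x) (X p) = frechet_derivative (\<lambda>x. ?F x (X p)) (at ?x) (Y p)"
    by (simp add: ext_deriv_def lessThan_Suc)
  then have "\<alpha> p [comp_deriv M X Y p] - \<alpha> p [comp_deriv M Y X p] = 0"
    using key[OF Y, of X] key[OF X, of Y] by linarith
  then show ?thesis using linear_diff[OF lin] by (simp add: bracket_def)
qed

text \<open>In a chart the components of the dual field solve the linear system whose matrix is the Gram matrix and whose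
  right-hand side consists of the components of the form; Cramer's rule writes the solution as
  a quotient of smooth functions.\<close>

lemma vector_field_sharp:
  assumes g: "riemannian_metric M" and \<alpha>: "differential_form M 1 \<alpha>"
  shows "vector_field M (sharp M \<alpha>)"
proof -
  have "smooth_on (snd c ` fst c) (vec_rep M c (sharp M \<alpha>))" if c: "c \<in> charts M" for c
  proof -
    let ?S = "snd c ` fst c" and ?X = "vec_rep M c (sharp M \<alpha>)"
    let ?b = "\<lambda>x i. form_rep M c \<alpha> x [axis i 1]"
    let ?A = "\<lambda>x k. \<chi> i j. if j = k then ?b x i else gram M c x $ i $ j"
    have S: "open ?S" by (rule open_chart_range[OF c])
    have G: "smooth_on ?S (\<lambda>x. gram M c x $ i $ j)" for i j
      using g c by (simp add: gram_def riemannian_metric_def)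
    have b: "smooth_on ?S (\<lambda>x. ?b x i)" for i using \<alpha> c by (simp add: differential_form_def)
    have mult: "(gram M c (snd c q) *v w) $ i = metric M q (from_chart M c q (axis i 1)) (from_chart M c q w)"
      if q: "q \<in> fst c" for q w i
    proof -
      let ?m = "\<lambda>w. metric M q (from_chart M c q (axis i 1)) (from_chart M c q w)"
      have lm: "linear (metric M q u)" for u
        using metric_scalar_product[OF g] by (simp add: scalar_product_def bilinear_def)
      have "linear ?m" by (rule linear_compose[OF linear_from_chart[OF c q] lm, unfolded o_def])
      from linear_axis_expand[OF this, of w] show ?thesis
        using is_chart_inv(1)[OF charts_is_chart[OF c] q]
        by (simp add: matrix_vector_mult_def gram_def metric_rep_def mult.commute)
    qed
    have det: "det (gram M c x) \<noteq> 0" if x: "x \<in> ?S" for x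
    proof -
      obtain q where q: "q \<in> fst c" "x = snd c q" using x by blast
      have "w = 0" if w: "gram M c x *v w = 0" for w
      proof -
        let ?m = "\<lambda>u. metric M q (from_chart M c q u) (from_chart M c q w)"
        have lm: "linear (\<lambda>u. metric M q u v)" for v
          using metric_scalar_product[OF g] by (simp add: scalar_product_def bilinear_def)
        have "linear ?m" by (rule linear_compose[OF linear_from_chart[OF c q(1)] lm, unfolded o_def])
        from linear_axis_expand[OF this, of w] have "?m w = 0"
          using w by (simp add: q mult[OF q(1), symmetric])
        then have "from_chart M c q w = 0"
          using metric_scalar_product[OF g, of q] by (metis less_irrefl scalar_product_def)
        then show ?thesis
          using to_chart_from_chart_self[OF c q(1), of w] linear_0[OF linear_to_chart[OF c q(1)]] by simp
      qed
      then show ?thesis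
        by (metis invertible_det_nz invertible_left_inverse matrix_left_invertible_ker)
    qed
    have "?X x = (\<chi> k. det (?A x k) / det (gram M c x))" if x: "x \<in> ?S" for x
    proof -
      obtain q where q: "q \<in> fst c" "x = snd c q" using x by blast
      have sym: "metric M q u v = metric M q v u" for u v
        using metric_scalar_product[OF g] by (simp add: scalar_product_def)
      have "gram M c x *v ?X x = (\<chi> i. ?b x i)"
        by (simp add: vec_eq_iff q mult[OF q(1)] vec_rep_at[OF c q(1)] from_chart_to_chart[OF c q(1)]
            form_rep_at[OF c q(1)] sym[of _ "sharp M \<alpha> q"] metric_sharp[OF g \<alpha>])
      then show ?thesis unfolding cramer[OF det[OF x]] vec_lambda_beta .
    qed
    moreover have "smooth_on ?S (\<lambda>x. \<chi> k. det (?A x k) / det (gram M c x))"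
    proof (rule smooth_on_vec[OF S])
      fix k
      have A: "smooth_on ?S (\<lambda>x. if j = k then ?b x i else gram M c x $ i $ j)" for i j
        using b G by (cases "j = k") simp_all
      show "smooth_on ?S (\<lambda>x. (\<chi> k. det (?A x k) / det (gram M c x)) $ k)"
        unfolding divide_inverse vec_lambda_beta
        by (intro smooth_on_mult S smooth_on_det smooth_on_inverse det G) (simp add: A)
    qed
    ultimately show ?thesis using smooth_on_cong[OF S, of "\<lambda>x. \<chi> k. det (?A x k) / det (gram M c x)" ?X] by simp
  qed
  then show ?thesis by (simp add: vector_field_on_def)
qed

end

lemma subspace_TF: "subspace (TF M)"
  by (simp add: TF_def subspace_def)

lemma dim_TF:
  fixes M :: "('a, 'n::finite) foliated_manifold"
  shows "dim (TF M) + codim M = CARD('n)"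
proof -
  have "TF M = {x. \<forall>i. i \<notin> - transv M \<longrightarrow> x $ i = 0}" by (auto simp: TF_def)
  then have "dim (TF M) = card (- transv M)"
    using dim_substandard_cart[of "- transv M", where 'a = real] by (simp add: dim_vec_eq)
  moreover have "card (transv M) + card (- transv M) = CARD('n)"
    using card_Un_disjoint[of "transv M" "- transv M"] by simp
  ultimately show ?thesis by (simp add: codim_def)
qed

text \<open>Parseval's identity for the orthonormal basis chosen in the definition of \<open>form_inner\<close>, once Gram-Schmidt has shown that
  such a basis exists.\<close>

lemma form_inner_one_forms:
  fixes M :: "('a::t2_space, 'n::finite) foliated_manifold"
  assumes g: "riemannian_metric M" and \<alpha>: "differential_form M 1 \<alpha>" and \<beta>: "differential_form M 1 \<beta>"
  shows "form_inner M 1 \<alpha> \<beta> p = metric M p (sharp M \<alpha> p) (sharp M \<beta> p)"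
proof -
  note sp = metric_scalar_product[OF g, of p]
  let ?e = "orthonormal_basis M p"
  have "\<exists>e :: 'n \<Rightarrow> real ^ 'n. \<forall>i j. metric M p (e i) (e j) = (if i = j then 1 else 0)"
    using orthonormal_frame_exists[OF sp] unfolding orthonormal_family_def ball_UNIV .
  from someI_ex[OF this] have e: "orthonormal_family (metric M p) UNIV ?e"
    unfolding orthonormal_family_def orthonormal_basis_def ball_UNIV .
  have "{is :: 'n list. length is = 1} = (\<lambda>i. [i]) ` UNIV"
    by (auto simp: length_Suc_conv)
  then have "form_inner M 1 \<alpha> \<beta> p = (\<Sum>i\<in>UNIV. \<alpha> p [?e i] * \<beta> p [?e i])"
    by (simp add: form_inner_def sum.reindex inj_on_def)
  also have "\<dots> = (\<Sum>i\<in>UNIV. metric M p (sharp M \<alpha> p) (?e i) * metric M p (sharp M \<beta> p) (?e i))"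
    by (simp only: metric_sharp[OF g \<alpha>] metric_sharp[OF g \<beta>])
  also have "\<dots> = metric M p (sharp M \<alpha> p) (sharp M \<beta> p)" by (rule orthonormal_frame_parseval[OF sp e])
  finally show ?thesis .
qed

lemma proj_Q_normal:
  assumes g: "scalar_product (metric M p)" and v: "v \<in> normal_space M p"
  shows "proj_Q M p v = v"
  unfolding proj_Q_def
proof (rule the_equality)
  show "v \<in> normal_space M p \<and> v - v \<in> TF M" using v by (simp add: TF_def)
  fix w assume w: "w \<in> normal_space M p \<and> v - w \<in> TF M"
  then have "metric M p v (v - w) = 0" "metric M p w (v - w) = 0"
    using v by (simp_all add: normal_space_def)
  then have "metric M p (v - w) (v - w) = 0"
    by (simp add: linear_diff[OF scalar_product_linear(2)[OF g]])
  then show "w = v" using scalar_product_eq_0[OF g] by fastforce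
qed

section \<open>Lie foliations from orthonormal closed basic one-forms\<close>

theorem proposition3p23:
  fixes M :: "('a::t2_space, 'n::finite) foliated_manifold"
    and \<alpha> :: "nat \<Rightarrow> ('a, 'n) form" and q :: nat
  assumes "ORFM M"
    and "transversely_formal M"
    and "basic_form M 1 (mean_curvature M)"
    and "basic_harmonic M 1 (mean_curvature M)"
    and "q = codim M"
    and "dim_basic_cohomology M 1 q"
    and "basis_mod {\<beta>. basic_harmonic M 1 \<beta>} {zero_form} q \<alpha>"
    and "\<And>i j p. i < q \<Longrightarrow> j < q \<Longrightarrow> form_inner M 1 (\<alpha> i) (\<alpha> j) p = (if i = j then 1 else 0)"
  shows "(\<forall>i<q. foliated M (sharp M (\<alpha> i))) \<and>
         (\<forall>i<q. \<forall>j<q. bracket M (sharp M (\<alpha> i)) (sharp M (\<alpha> j)) \<in> sections_TF M) \<and>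
         abelian_lie_foliation M"
proof -
  let ?X = "\<lambda>i. sharp M (\<alpha> i)"
  have atlas: "foliated_atlas M" and g: "riemannian_metric M" using assms(1) by (simp_all add: ORFM_def)
  note sp = metric_scalar_product[OF g]
  have "basic_harmonic M 1 (\<alpha> i)" if "i < q" for i using assms(7) that by (simp add: basis_mod_def)
  then have basic: "basic_form M 1 (\<alpha> i)" and form: "differential_form M 1 (\<alpha> i)"
    and closed: "ext_deriv M (\<alpha> i) = zero_form" if "i < q" for i
    using that by (auto simp: basic_harmonic_def basic_form_def)
  have X: "vector_field M (?X i)" if "i < q" for i by (rule vector_field_sharp[OF atlas g form[OF that]])
  have on: "metric M p (?X i p) (?X j p) = (if i = j then 1 else 0)" if "i < q" "j < q" for i j p
    using assms(8)[OF that, of p] form_inner_one_forms[OF g form form, OF that, of p] by simp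
  then have orth: "orthonormal_family (metric M p) {..<q} (\<lambda>i. ?X i p)" for p
    by (simp add: orthonormal_family_def)
  have XT: "metric M p (?X i p) t = 0" if "i < q" "t \<in> TF M" for i t p
    using metric_sharp[OF g form[OF that(1)]] basic_one_form_TF[OF atlas basic[OF that(1)] that(2)] by simp
  \<comment> \<open>The inclusion of \<open>TF\<close> in the common kernel becomes an equality, as the dimensions agree.\<close>
  have TFI: "v \<in> TF M" if "\<And>j. j < q \<Longrightarrow> \<alpha> j p [v] = 0" for v p
    by (rule orthogonal_complement_eq[OF sp orth finite_lessThan subspace_TF])
      (use dim_TF[of M] assms(5) XT that metric_sharp[OF g form] in auto)
  \<comment> \<open>Used for sections \<open>Y\<close> of \<open>TF\<close>, where the functions \<open>\<alpha>\<^sub>j(Y)\<close> are \<open>0\<close>, and for \<open>Y = X\<^sub>k\<close>, where they are \<open>\<delta>\<^sub>j\<^sub>k\<close>.\<close>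
  have bracket: "bracket M (?X i) Y \<in> sections_TF M"
    if i: "i < q" and Y: "vector_field M Y" "\<And>j p p'. j < q \<Longrightarrow> \<alpha> j p [Y p] = \<alpha> j p' [Y p']" for i Y
  proof -
    have "\<alpha> j p [bracket M (?X i) Y p] = 0" if j: "j < q" for j p
    proof (rule closed_one_form_bracket[OF atlas form[OF j] closed[OF j] X[OF i] _ Y(1)])
      show "\<alpha> j p' [?X i p'] = (if j = i then 1 else 0)" for p'
        using on[OF j i, of p'] metric_sharp[OF g form[OF j]] by simp
      show "\<alpha> j p' [Y p'] = \<alpha> j p [Y p]" for p' by (rule Y(2)[OF j])
    qed
    then have "bracket M (?X i) Y p \<in> TF M" for p by (rule TFI)
    then show ?thesis using vector_field_bracket[OF atlas X[OF i] Y(1)] by (simp add: sections_TF_def)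
  qed
  have fol: "foliated M (?X i)" if i: "i < q" for i
    unfolding foliated_def
  proof (intro conjI ballI)
    fix Y assume Y: "Y \<in> sections_TF M"
    then have vanish: "\<alpha> j p [Y p] = 0" if "j < q" for j p
      using that basic_one_form_TF[OF atlas basic[OF that]] by (simp add: sections_TF_def)
    then show "bracket M (?X i) Y \<in> sections_TF M"
      using Y by (intro bracket i) (simp_all add: sections_TF_def vanish)
  qed (rule X[OF i])
  have comm: "bracket M (?X i) (?X j) \<in> sections_TF M" if "i < q" "j < q" for i j
  proof (rule bracket[OF that(1) X[OF that(2)]])
    fix k p p' assume k: "k < q"
    show "\<alpha> k p [?X j p] = \<alpha> k p' [?X j p']"
      using on[OF k that(2)] metric_sharp[OF g form[OF k]] by simp
  qed
  have indep: "\<forall>i<q. a i = 0" if "(\<Sum>i<q. a i *\<^sub>R proj_Q M p (?X i p)) = 0" for p a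
  proof (intro allI impI)
    fix j assume j: "j < q"
    have "proj_Q M p (?X i p) = ?X i p" if "i < q" for i
      using XT[OF that] by (intro proj_Q_normal sp) (simp add: normal_space_def)
    then have "(\<Sum>i<q. a i *\<^sub>R ?X i p) = 0" using that by simp
    moreover have "metric M p (\<Sum>i<q. a i *\<^sub>R ?X i p) (?X j p) = a j"
      by (rule orthonormal_sum[OF sp orth finite_lessThan]) (use j in simp)
    ultimately show "a j = 0" using linear_0[OF scalar_product_linear(2)[OF sp]] by simp
  qed
  have "abelian_lie_foliation M"
    unfolding lie_foliation_def lie_structure_constants_def assms(5)[symmetric]
    using fol comm indep by (auto intro!: exI[of _ ?X])
  with fol comm show ?thesis by blast
qed

end
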